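(* Let $f_\sigma$ be the unique fixed point of $P_\sigma$, and let $P_{\sigma,k}$ be its Galerkin approximation. For $i\in\mathbb{N}_0$ set $C_i:=\|P_{\sigma,k}^i|_{\mathcal{U}_0}\|_{L^2\to L^2}$, and suppose that $C_n<1$ for some $n\in\mathbb{N}$. Let $g$ be a trigonometric polynomial of degree at most $k$ such that $\|P_{\sigma,k}g-g\|_{L^2}\le\epsilon$. Then $$\|f_\sigma-g\|_{L^2}\le\frac{1}{1-C_n}\sum_{i=0}^{n-1}C_i\left((1+\Gamma_{\sigma,k}+\|\rho_\sigma\|_{L^2(\mathbb{R})})\,\Gamma^{(1)}_{\sigma,k}\,\|f_\sigma\|_{L^1}+\epsilon\right)$$ and $$\|f_\sigma-g\|_{L^2}\le\frac{1}{1-C_n}\sum_{i=0}^{n-1}C_i\,(\delta+\epsilon),$$ where $\delta=\|P_{\sigma,k}f_\sigma-f_\sigma\|_{L^2}$ satisfies $$\delta\le\left(\Gamma_{\sigma,k}(1+\Gamma^{(1)}_{\sigma,k})+\|\rho_\sigma\|_{L^2(\mathbb{R})}\sqrt{\coth\left(\frac{1}{2\sigma^2}\right)}\cdot\Gamma^{(1)}_{\sigma,k}\right)\|f_\sigma\|_{L^1}.$$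
   Context: $\sigma>0$; $m$ is (non-normalized) Lebesgue measure on $[-1,1]$ and $L^p=L^p([-1,1],m)$. $T:[-1,1]\to[-1,1]$ is measurable and non-singular ($m(T^{-1}A)=0$ whenever $m(A)=0$); $P:L^1\to L^1$ is its Perron–Frobenius operator ($Pf$ is the density of the pushforward of $f\,dm$ by $T$). $\rho_\sigma(x)=\frac{1}{\sigma\sqrt{2\pi}}e^{-x^2/(2\sigma^2)}$, $N_\sigma f(x)=\sum_{j\in\mathbb{Z}}\int_{-1}^1\rho_\sigma(x+2j-y)f(y)\,dy$, and $P_\sigma=N_\sigma P$ is the annealed Perron–Frobenius operator; its unique fixed point $f_\sigma$ is the unique stationary density of the associated random dynamical system with Gaussian noise. $\mathcal{F}(f)[j]=\frac12\int_{-1}^1f(x)e^{-j\pi i x}dx$, $\pi_kf(x)=\sum_{|j|\le k}\mathcal{F}(f)[j]e^{j\pi i x}$, and $P_{\sigma,k}=\pi_kP_\sigma\pi_k$. A trigonometric polynomial of degree at most $k$ is a linear combination of $e^{j\pi i x}$, $|j|\le k$. $\mathcal{U}_0=\{f\in L^2:\int f\,dm=0\}$. Constants: $\Gamma_{\sigma,k}=\sqrt{\frac{1}{\sigma\sqrt\pi}\coth(\frac{1}{2\sigma^2})}\,e^{-\sigma^2\pi^2k^2/2}$ and $\Gamma^{(1)}_{\sigma,k}=\sum_{|j|>k}e^{-\sigma^2\pi^2j^2/2}$.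
   Formalization: The formal theorem additionally assumes that g has integral 1 over [-1,1] (so that f_σ − g lies in U_0); without it the claim fails, e.g. T = id, g = 0, ε = 0, f_σ = 1/2, k ≥ 1, n = 1, where δ = 0 but f_σ − g is not zero. *)

theory Defs
  imports "HOL-Probability.Probability"
begin

text \<open>
  \<open>L\<^sup>1\<close> and \<open>L\<^sup>2\<close> are complex-valued throughout. Their elements are represented by
  functions rather than by classes modulo null sets: nothing below depends on the choice of
  representative, and equality of elements is spelled out as equality almost everywhere.
\<close>

abbreviation m :: "real measure" where
  "m \<equiv> lebesgue_on {-1..1}"

text \<open>
  Both norms are Bochner integrals and hence return 0 for functions that are not (square)
  integrable; they are applied only to elements of \<open>L\<^sup>1\<close> and \<open>L\<^sup>2\<close>, respectively.
  The measure is a parameter because the norm in \<open>L\<^sup>2(\<real>)\<close> is needed as well.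
\<close>

definition L1_norm :: "'a measure \<Rightarrow> ('a \<Rightarrow> 'b::real_normed_vector) \<Rightarrow> real" where
  "L1_norm M f = (\<integral>x. norm (f x) \<partial>M)"

definition L2_norm :: "'a measure \<Rightarrow> ('a \<Rightarrow> 'b::real_normed_vector) \<Rightarrow> real" where
  "L2_norm M f = sqrt (\<integral>x. (norm (f x))\<^sup>2 \<partial>M)"

definition L2 :: "(real \<Rightarrow> complex) set" where
  "L2 = {f \<in> borel_measurable m. integrable m (\<lambda>x. (norm (f x))\<^sup>2)}"

definition U0 :: "(real \<Rightarrow> complex) set" where
  "U0 = {f \<in> L2. (\<integral>x. f x \<partial>m) = 0}"

text \<open>
  The formula is that of \<^const>\<open>onorm\<close>. As there, a function of norm 0 contributes the
  quotient \<open>x / 0 = 0\<close>, and the supremum is meaningful only for operators bounded on \<open>U\<close>.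
\<close>

definition L2_opnorm_on ::
  "(real \<Rightarrow> complex) set \<Rightarrow> ((real \<Rightarrow> complex) \<Rightarrow> (real \<Rightarrow> complex)) \<Rightarrow> real" where
  "L2_opnorm_on U A = (SUP f\<in>U. L2_norm m (A f) / L2_norm m f)"

definition nonsingular_map :: "(real \<Rightarrow> real) \<Rightarrow> bool" where
  "nonsingular_map T \<longleftrightarrow>
     T \<in> m \<rightarrow>\<^sub>M m \<and> (\<forall>A\<in>sets m. emeasure m A = 0 \<longrightarrow> emeasure m (T -` A \<inter> {-1..1}) = 0)"

text \<open>
  \<open>h\<close> is a density, with respect to \<open>m\<close>, of the pushforward by \<open>T\<close> of the complex measure
  \<open>f dm\<close>. For nonsingular \<open>T\<close> and integrable \<open>f\<close> such an \<open>h\<close> exists by Radon-Nikodym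
  and is determined up to null sets; \<open>perron_frobenius\<close> picks a representative.
\<close>

definition is_pushforward_density ::
  "(real \<Rightarrow> real) \<Rightarrow> (real \<Rightarrow> complex) \<Rightarrow> (real \<Rightarrow> complex) \<Rightarrow> bool" where
  "is_pushforward_density T f h \<longleftrightarrow>
     integrable m h \<and> (\<forall>A\<in>sets m. (LINT x:A|m. h x) = (LINT x:(T -` A \<inter> {-1..1})|m. f x))"

definition perron_frobenius :: "(real \<Rightarrow> real) \<Rightarrow> (real \<Rightarrow> complex) \<Rightarrow> (real \<Rightarrow> complex)" where
  "perron_frobenius T f = (SOME h. is_pushforward_density T f h)"

abbreviation gauss :: "real \<Rightarrow> real \<Rightarrow> real" where
  "gauss \<sigma> \<equiv> normal_density 0 \<sigma>"

definition noise :: "real \<Rightarrow> (real \<Rightarrow> complex) \<Rightarrow> (real \<Rightarrow> complex)" where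
  "noise \<sigma> f = (\<lambda>x. \<Sum>\<^sub>\<infinity>j::int. \<integral>y. of_real (gauss \<sigma> (x + 2 * of_int j - y)) * f y \<partial>m)"

definition annealed_PF ::
  "(real \<Rightarrow> real) \<Rightarrow> real \<Rightarrow> (real \<Rightarrow> complex) \<Rightarrow> (real \<Rightarrow> complex)" where
  "annealed_PF T \<sigma> f = noise \<sigma> (perron_frobenius T f)"

definition fourier_basis :: "int \<Rightarrow> real \<Rightarrow> complex" where
  "fourier_basis j x = exp (of_int j * of_real pi * \<i> * of_real x)"

definition fourier_coeff :: "(real \<Rightarrow> complex) \<Rightarrow> int \<Rightarrow> complex" where
  "fourier_coeff f j = 1/2 * (\<integral>x. f x * fourier_basis (- j) x \<partial>m)"

definition fourier_proj :: "nat \<Rightarrow> (real \<Rightarrow> complex) \<Rightarrow> (real \<Rightarrow> complex)" where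
  "fourier_proj k f = (\<lambda>x. \<Sum>j\<in>{j. \<bar>j\<bar> \<le> int k}. fourier_coeff f j * fourier_basis j x)"

definition galerkin_PF ::
  "(real \<Rightarrow> real) \<Rightarrow> real \<Rightarrow> nat \<Rightarrow> (real \<Rightarrow> complex) \<Rightarrow> (real \<Rightarrow> complex)" where
  "galerkin_PF T \<sigma> k f = fourier_proj k (annealed_PF T \<sigma> (fourier_proj k f))"

definition trig_poly_degree_le :: "nat \<Rightarrow> (real \<Rightarrow> complex) \<Rightarrow> bool" where
  "trig_poly_degree_le k g \<longleftrightarrow>
     (\<exists>c. \<forall>x. g x = (\<Sum>j\<in>{j. \<bar>j\<bar> \<le> int k}. c j * fourier_basis j x))"

text \<open>
  Fixed points of the annealed operator are normalised to be probability densities. Uniqueness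
  up to null sets is not part of the predicate: it holds automatically for nonsingular \<open>T\<close>
  and \<open>\<sigma> > 0\<close>, the noise kernel being strictly positive.
\<close>

definition stationary_density :: "(real \<Rightarrow> real) \<Rightarrow> real \<Rightarrow> (real \<Rightarrow> complex) \<Rightarrow> bool" where
  "stationary_density T \<sigma> f \<longleftrightarrow>
     integrable m f \<and> (AE x in m. f x \<in> \<real>\<^sub>\<ge>\<^sub>0) \<and> (\<integral>x. f x \<partial>m) = 1 \<and>
     (AE x in m. annealed_PF T \<sigma> f x = f x)"

definition coth :: "real \<Rightarrow> real" where
  "coth x = cosh x / sinh x"

definition Gamma0 :: "real \<Rightarrow> nat \<Rightarrow> real" where
  "Gamma0 \<sigma> k =
     sqrt (1 / (\<sigma> * sqrt pi) * coth (1 / (2 * \<sigma>\<^sup>2))) * exp (- (\<sigma>\<^sup>2 * pi\<^sup>2 * (real k)\<^sup>2 / 2))"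

definition Gamma1 :: "real \<Rightarrow> nat \<Rightarrow> real" where
  "Gamma1 \<sigma> k = (\<Sum>\<^sub>\<infinity>j\<in>{j::int. \<bar>j\<bar> > int k}. exp (- (\<sigma>\<^sup>2 * pi\<^sup>2 * (of_int j)\<^sup>2 / 2)))"

end

theory Submission
  imports Defs
begin

text \<open>
  In the Fourier basis the noise is diagonal. Poisson summation (\<open>theta_Poisson\<close>) gives the
  periodised Gaussian the coefficients \<open>exp (- \<sigma>\<^sup>2 \<pi>\<^sup>2 l\<^sup>2 / 2) / 2\<close>, so the noise multiplies
  the \<open>l\<close>-th coefficient by \<open>exp (- \<sigma>\<^sup>2 \<pi>\<^sup>2 l\<^sup>2 / 2)\<close>. By duality the \<open>l\<close>-th coefficient
  of the transferred density \<open>P u\<close> is half the integral of \<open>u\<close> against \<open>e\<^sub>-\<^sub>l \<circ> T\<close>, which is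
  at most half the \<open>L\<^sup>1\<close>-norm of \<open>u\<close>. Together (\<open>annealed_PF_has_sum\<close>) they make the annealed
  operator an absolutely convergent Fourier series whose coefficients are explicit linear
  functionals of \<open>u\<close>; in particular the annealed and the Galerkin operators are linear
  pointwise, although \<open>P\<close> itself is only chosen up to null sets.

  The residual of the fixed point \<open>f\<close> splits as \<open>f - P\<^sub>\<sigma>\<^sub>,\<^sub>k f = v + \<pi>\<^sub>k P\<^sub>\<sigma> v\<close>, where \<open>v\<close> is
  the part of \<open>f\<close> with frequencies above \<open>k\<close>. Since \<open>f = P\<^sub>\<sigma> f\<close>, its high coefficients are
  Gaussian-small: summing them bounds \<open>v\<close> uniformly, and hence in \<open>L\<^sup>2\<close>, by a multiple of \<open>\<Gamma>\<^sup>1\<close>,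
  while Parseval bounds its \<open>L\<^sup>2\<close>-norm by a multiple of \<open>\<Gamma>\<close> (\<open>annealed_PF_tail\<close>).
  For the second summand the decisive point is that \<open>v\<close> has mean zero. As \<open>P\<^sub>\<sigma>\<close> preserves
  mass, frequency 0 does not occur in \<open>\<pi>\<^sub>k P\<^sub>\<sigma> v\<close>, and the sum of \<open>exp (- \<sigma>\<^sup>2 \<pi>\<^sup>2 l\<^sup>2)\<close> over
  the remaining frequencies is at most the Gaussian integral, which equals twice the squared
  \<open>L\<^sup>2\<close>-norm of \<open>\<rho>\<^sub>\<sigma>\<close> (\<open>zero_mean_smoothing\<close>). The first estimate for \<open>v\<close> leads to
  the a priori bound on the error, the second to the bound on \<open>\<delta>\<close>, because the hyperbolic
  cotangent of a positive number is at least 1.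

  The error \<open>u = f - g\<close> has mean zero, and mean zero is preserved by \<open>A = P\<^sub>\<sigma>\<^sub>,\<^sub>k\<close>. Telescoping
  \<open>A\<^sup>n u - u\<close> into the iterates \<open>A\<^sup>i (A u - u)\<close> bounds \<open>(1 - C\<^sub>n)\<close> times the norm of \<open>u\<close> by
  the sum of \<open>C\<^sub>i\<close> times the norm of \<open>A u - u\<close> (\<open>galerkin_PF_norm_le_defect\<close>), and \<open>A u - u\<close>
  is the difference of the residuals of \<open>f\<close> and \<open>g\<close>.
\<close>

section \<open>Square-integrable functions on the interval\<close>

interpretation m: finite_measure m
  by (rule finite_measure_lebesgue_on) simp

lemma measure_m: "measure m {-1..1} = 2"
  by (subst measure_restrict_space) auto

lemma integral_const_m: "(\<integral>x. c \<partial>m) = 2 * (c::real)"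
  by (simp only: lebesgue_integral_const space_lebesgue_on measure_m) simp

lemma continuous_imp_measurable_m:
  "continuous_on UNIV f \<Longrightarrow> (f :: real \<Rightarrow> complex) \<in> borel_measurable m"
  by (rule continuous_imp_measurable_on_sets_lebesgue[OF continuous_on_subset]) auto

lemma bounded_imp_integrable_m:
  assumes "f \<in> borel_measurable m" "AE x in m. norm (f x) \<le> B"
  shows "integrable m (f :: real \<Rightarrow> complex)"
  by (rule m.integrable_const_bound[OF assms(2) assms(1)])

lemma bounded_imp_L2:
  assumes [measurable]: "f \<in> borel_measurable m" and "AE x in m. norm (f x) \<le> B"
  shows "f \<in> L2" "L2_norm m f \<le> sqrt 2 * B"
proof -
  have le: "AE x in m. norm ((norm (f x))\<^sup>2) \<le> B\<^sup>2"
    using assms(2) by eventually_elim (simp add: power_mono)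
  have int: "integrable m (\<lambda>x. (norm (f x))\<^sup>2)"
    by (rule m.integrable_const_bound[OF le]) simp
  then show "f \<in> L2" by (simp add: L2_def)
  have "(\<integral>x. (norm (f x))\<^sup>2 \<partial>m) \<le> (\<integral>x. B\<^sup>2 \<partial>m)"
    using le by (intro integral_mono_AE int) auto
  also have "\<dots> = 2 * B\<^sup>2" by (rule integral_const_m)
  finally have "L2_norm m f \<le> sqrt (2 * B\<^sup>2)"
    unfolding L2_norm_def by (rule real_sqrt_le_mono)
  moreover have "sqrt (2 * B\<^sup>2) = sqrt 2 * B"
  proof -
    have "AE x in m. 0 \<le> B" using assms(2) by eventually_elim (meson norm_ge_zero order_trans)
    then have "0 \<le> (\<integral>x. B \<partial>m)" by (rule integral_nonneg_AE)
    then have "B \<ge> 0" unfolding integral_const_m by (simp only: zero_le_mult_iff) linarith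
    then show ?thesis unfolding real_sqrt_mult by (simp only: real_sqrt_abs abs_of_nonneg)
  qed
  ultimately show "L2_norm m f \<le> sqrt 2 * B" by (simp only:)
qed

lemma L2_sum_diff_product:
  assumes "f \<in> L2" "g \<in> L2"
  shows "(\<lambda>x. f x + g x) \<in> L2" "(\<lambda>x. f x - g x) \<in> L2"
    "integrable m (\<lambda>x. norm (f x) * norm (g x))"
proof -
  have [measurable]: "f \<in> borel_measurable m" "g \<in> borel_measurable m"
    and int: "integrable m (\<lambda>x. (norm (f x))\<^sup>2)" "integrable m (\<lambda>x. (norm (g x))\<^sup>2)"
    using assms by (auto simp: L2_def)
  have sq: "(norm (f x) + norm (g x))\<^sup>2 \<le> 2 * ((norm (f x))\<^sup>2 + (norm (g x))\<^sup>2)" for x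
    using zero_le_power2[of "norm (f x) - norm (g x)"] by (simp add: power2_eq_square algebra_simps)
  have dom: "integrable m (\<lambda>x. 2 * ((norm (f x))\<^sup>2 + (norm (g x))\<^sup>2))"
    using int by simp
  have "(norm (f x + g x))\<^sup>2 \<le> 2 * ((norm (f x))\<^sup>2 + (norm (g x))\<^sup>2)" for x
    by (rule order_trans[OF power_mono[OF norm_triangle_ineq] sq]) simp
  then have "integrable m (\<lambda>x. (norm (f x + g x))\<^sup>2)"
    by (intro Bochner_Integration.integrable_bound[OF dom]) auto
  then show "(\<lambda>x. f x + g x) \<in> L2" by (simp add: L2_def)
  have "(norm (f x - g x))\<^sup>2 \<le> 2 * ((norm (f x))\<^sup>2 + (norm (g x))\<^sup>2)" for x
    by (rule order_trans[OF power_mono[OF norm_triangle_ineq4] sq]) simp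
  then have "integrable m (\<lambda>x. (norm (f x - g x))\<^sup>2)"
    by (intro Bochner_Integration.integrable_bound[OF dom]) auto
  then show "(\<lambda>x. f x - g x) \<in> L2" by (simp add: L2_def)
  have "norm (f x) * norm (g x) \<le> 2 * ((norm (f x))\<^sup>2 + (norm (g x))\<^sup>2)" for x
  proof -
    have "2 * (norm (f x) * norm (g x)) \<le> (norm (f x))\<^sup>2 + (norm (g x))\<^sup>2"
      using sum_squares_bound[of "norm (f x)" "norm (g x)"] by (simp add: mult.assoc)
    moreover have "0 \<le> norm (f x) * norm (g x)" by simp
    moreover have "c \<le> 2 * S" if "2 * c \<le> S" "0 \<le> c" for c S :: real
      using that by linarith
    ultimately show ?thesis by blast
  qed
  then show "integrable m (\<lambda>x. norm (f x) * norm (g x))"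
    by (intro Bochner_Integration.integrable_bound[OF dom]) auto
qed

lemma L2_norm_nonneg: "0 \<le> L2_norm M f"
  unfolding L2_norm_def by (simp add: integral_nonneg_AE)

lemma L2_norm_power2: "(L2_norm M f)\<^sup>2 = (\<integral>x. (norm (f x))\<^sup>2 \<partial>M)"
  unfolding L2_norm_def by (simp add: integral_nonneg_AE)

lemma L2_norm_cong_AE:
  assumes "AE x in m. f x = g x" "f \<in> borel_measurable m" "g \<in> borel_measurable m"
  shows "L2_norm m f = L2_norm m g"
  unfolding L2_norm_def
  using assms by (intro arg_cong[where f=sqrt] integral_cong_AE) auto

text \<open>
  The quadratic polynomial \<open>t \<mapsto> \<parallel>t \<bar>f\<bar> - \<bar>g\<bar>\<parallel>\<^sup>2\<close> is nonnegative, so its discriminant is not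
  positive.
\<close>

lemma L2_Cauchy_Schwarz:
  assumes f: "f \<in> L2" and g: "g \<in> L2"
  shows "(\<integral>x. norm (f x) * norm (g x) \<partial>m) \<le> L2_norm m f * L2_norm m g"
proof -
  define A B D where "A = (L2_norm m f)\<^sup>2" and "B = (\<integral>x. norm (f x) * norm (g x) \<partial>m)"
    and "D = (L2_norm m g)\<^sup>2"
  have int: "integrable m (\<lambda>x. (norm (f x))\<^sup>2)" "integrable m (\<lambda>x. (norm (g x))\<^sup>2)"
    "integrable m (\<lambda>x. norm (f x) * norm (g x))"
    using f g L2_sum_diff_product by (auto simp: L2_def)
  have quad: "0 \<le> t\<^sup>2 * A - 2 * t * B + D" for t
  proof -
    have "0 \<le> (\<integral>x. (t * norm (f x) - norm (g x))\<^sup>2 \<partial>m)" by (intro integral_nonneg_AE) simp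
    also have "\<dots> = (\<integral>x. t\<^sup>2 * (norm (f x))\<^sup>2 - 2 * t * (norm (f x) * norm (g x)) + (norm (g x))\<^sup>2 \<partial>m)"
      by (intro Bochner_Integration.integral_cong refl) (simp add: power2_eq_square algebra_simps)
    also have "\<dots> = t\<^sup>2 * A - 2 * t * B + D"
      using int by (simp add: A_def B_def D_def L2_norm_power2)
    finally show ?thesis .
  qed
  have "B\<^sup>2 \<le> A * D"
  proof (cases "A = 0")
    case True
    have "B = 0"
    proof (rule ccontr)
      assume "B \<noteq> 0"
      then have "(D + 1) / (2 * B) * (2 * B) = D + 1" by simp
      then show False using quad[of "(D + 1) / (2 * B)"] True by (simp add: mult.commute mult.left_commute)
    qed
    then show ?thesis using True by simp
  next
    case False
    then have "A > 0" unfolding A_def by simp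
    then show ?thesis using quad[of "B / A"] by (simp add: power2_eq_square field_simps)
  qed
  then have "B\<^sup>2 \<le> (L2_norm m f * L2_norm m g)\<^sup>2" by (simp add: A_def D_def power_mult_distrib)
  then show ?thesis
    unfolding B_def by (rule power2_le_imp_le) (simp add: L2_norm_nonneg)
qed

lemma L2_norm_triangle:
  assumes f: "f \<in> L2" and g: "g \<in> L2"
  shows "L2_norm m (\<lambda>x. f x + g x) \<le> L2_norm m f + L2_norm m g"
proof (rule power2_le_imp_le)
  have int: "integrable m (\<lambda>x. (norm (f x))\<^sup>2)" "integrable m (\<lambda>x. (norm (g x))\<^sup>2)"
    "integrable m (\<lambda>x. norm (f x) * norm (g x))"
    "integrable m (\<lambda>x. (norm (f x + g x))\<^sup>2)"
    using f g L2_sum_diff_product by (auto simp: L2_def)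
  have "(L2_norm m (\<lambda>x. f x + g x))\<^sup>2
      \<le> (\<integral>x. (norm (f x))\<^sup>2 + 2 * (norm (f x) * norm (g x)) + (norm (g x))\<^sup>2 \<partial>m)"
    unfolding L2_norm_power2
  proof (rule integral_mono)
    fix x
    have "(norm (f x + g x))\<^sup>2 \<le> (norm (f x) + norm (g x))\<^sup>2"
      by (intro power_mono norm_triangle_ineq) simp
    then show "(norm (f x + g x))\<^sup>2 \<le> (norm (f x))\<^sup>2 + 2 * (norm (f x) * norm (g x)) + (norm (g x))\<^sup>2"
      by (simp add: power2_eq_square algebra_simps)
  qed (use int in simp_all)
  also have "\<dots> = (L2_norm m f)\<^sup>2 + 2 * (\<integral>x. norm (f x) * norm (g x) \<partial>m) + (L2_norm m g)\<^sup>2"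
    using int by (simp add: L2_norm_power2)
  also have "\<dots> \<le> (L2_norm m f + L2_norm m g)\<^sup>2"
    using L2_Cauchy_Schwarz[OF f g] by (simp add: power2_eq_square algebra_simps)
  finally show "(L2_norm m (\<lambda>x. f x + g x))\<^sup>2 \<le> (L2_norm m f + L2_norm m g)\<^sup>2" .
qed (simp add: L2_norm_nonneg)

lemma L2_norm_minus: "L2_norm M (\<lambda>x. - f x) = L2_norm M f"
  by (simp add: L2_norm_def)

lemma L2_norm_minus_commute: "L2_norm M (\<lambda>x. f x - g x) = L2_norm M (\<lambda>x. g x - f x)"
  by (simp add: L2_norm_def norm_minus_commute)

lemma L2_norm_triangle_diff:
  assumes f: "f \<in> L2" and g: "g \<in> L2"
  shows "L2_norm m (\<lambda>x. f x - g x) \<le> L2_norm m f + L2_norm m g"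
proof -
  have "(\<lambda>x. - g x) \<in> L2" using g by (simp add: L2_def)
  from L2_norm_triangle[OF f this] show ?thesis by (simp add: L2_norm_minus)
qed

lemma L2_imp_integrable:
  assumes "f \<in> L2" shows "integrable m f"
proof -
  have one: "(\<lambda>x. 1) \<in> L2" by (rule bounded_imp_L2[where B=1]) auto
  have "integrable m (\<lambda>x. norm (f x))" using L2_sum_diff_product(3)[OF assms one] by simp
  moreover have "f \<in> borel_measurable m" using assms by (simp add: L2_def)
  ultimately show ?thesis by (simp add: integrable_norm_iff)
qed

lemma L1_norm_le_L2_norm:
  assumes "f \<in> L2" shows "L1_norm m f \<le> sqrt 2 * L2_norm m f"
proof -
  have one: "(\<lambda>x. 1) \<in> L2" "L2_norm m (\<lambda>x. 1::complex) \<le> sqrt 2 * 1"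
    by (rule bounded_imp_L2[where B=1]; simp)+
  have "L1_norm m f \<le> L2_norm m f * L2_norm m (\<lambda>x. 1::complex)"
    using L2_Cauchy_Schwarz[OF assms one(1)] by (simp add: L1_norm_def)
  also have "\<dots> \<le> L2_norm m f * sqrt 2"
    using one(2) by (intro mult_left_mono) (simp_all add: L2_norm_nonneg)
  finally show ?thesis by (simp add: mult.commute)
qed

section \<open>The Fourier basis\<close>

lemma fourier_basis_eq_cis: "fourier_basis j x = cis (of_int j * pi * x)"
  by (simp add: fourier_basis_def cis_conv_exp mult_ac)

lemma norm_fourier_basis [simp]: "norm (fourier_basis j x) = 1"
  by (simp add: fourier_basis_eq_cis)

lemma fourier_basis_0 [simp]: "fourier_basis 0 x = 1"
  by (simp add: fourier_basis_eq_cis)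

lemma fourier_basis_mult: "fourier_basis i x * fourier_basis j x = fourier_basis (i + j) x"
  by (simp add: fourier_basis_eq_cis cis_mult algebra_simps)

lemma fourier_basis_add: "fourier_basis j (x + y) = fourier_basis j x * fourier_basis j y"
  by (simp add: fourier_basis_eq_cis cis_mult algebra_simps)

lemma fourier_basis_uminus: "fourier_basis (- j) x = cnj (fourier_basis j x)"
  by (simp add: fourier_basis_eq_cis cis_cnj)

lemma fourier_basis_neg_arg: "fourier_basis j (- x) = fourier_basis (- j) x"
  by (simp add: fourier_basis_eq_cis)

lemma fourier_basis_even_int [simp]: "fourier_basis j (2 * of_int n) = 1"
proof -
  have "fourier_basis j (2 * of_int n) = cis (2 * pi * of_int (j * n))"
    by (simp add: fourier_basis_eq_cis mult_ac)
  also have "\<dots> = 1" by (rule cis_multiple_2pi) simp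
  finally show ?thesis .
qed

lemma continuous_fourier_basis: "continuous_on A (fourier_basis j)"
  unfolding fourier_basis_def by (intro continuous_intros)

lemma borel_measurable_fourier_basis [measurable]: "fourier_basis j \<in> borel_measurable borel"
  by (rule borel_measurable_continuous_onI[OF continuous_fourier_basis])

lemma fourier_basis_measurable_m [measurable]: "fourier_basis j \<in> borel_measurable m"
  by (rule continuous_imp_measurable_m[OF continuous_fourier_basis])

lemma integrable_mult_fourier_basis:
  assumes "integrable m f" shows "integrable m (\<lambda>x. f x * fourier_basis j x)"
  by (rule Bochner_Integration.integrable_bound[OF assms]) (use assms in \<open>auto simp: norm_mult\<close>)

lemma integrable_fourier_basis: "integrable m (fourier_basis j)"
  by (rule bounded_imp_integrable_m[where B=1]) auto

lemma integral_fourier_basis: "(\<integral>x. fourier_basis j x \<partial>m) = (if j = 0 then 2 else 0)"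
proof (cases "j = 0")
  case True
  have "(\<integral>x. fourier_basis j x \<partial>m) = measure m (space m) *\<^sub>R (1::complex)"
    unfolding True fourier_basis_0 by (rule lebesgue_integral_const)
  then show ?thesis using True measure_m by (simp add: scaleR_conv_of_real)
next
  case False
  define F where "F = (\<lambda>x. fourier_basis j x / (of_int j * of_real pi * \<i>))"
  have "(F has_vector_derivative fourier_basis j x) (at x within {-1..1})" for x
  proof -
    have "((\<lambda>z. exp (of_int j * of_real pi * \<i> * z) / (of_int j * of_real pi * \<i>))
        has_field_derivative fourier_basis j x) (at (of_real x))"
      using False by (auto intro!: derivative_eq_intros simp: fourier_basis_def)
    from has_vector_derivative_real_field[OF this] show ?thesis
      unfolding F_def fourier_basis_def .
  qed
  then have "(fourier_basis j has_integral (F 1 - F (-1))) {-1..1}"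
    by (intro fundamental_theorem_of_calculus) auto
  moreover have "F 1 = F (-1)"
    using fourier_basis_add[of j "-1" 2] fourier_basis_even_int[of j 1] by (simp add: F_def)
  ultimately have "integral {-1..1} (fourier_basis j) = 0" by (simp add: integral_unique)
  then show ?thesis
    using False lebesgue_integral_eq_integral[OF integrable_fourier_basis] by simp
qed

section \<open>Interchanging sums over the integers with integrals\<close>

lemma has_sum_imp_abs_summable:
  "(f has_sum s) A \<Longrightarrow> (\<lambda>j. norm (f j :: complex)) summable_on A"
  using has_sum_imp_summable summable_on_iff_abs_summable_on_complex by blast

text \<open>
  Summability of the \<open>L\<^sup>1\<close>-norms allows the exchange for series; an enumeration of the integers
  transports this to unordered sums. The sums over frequencies and over translates below are exchanged with
  integrals by this lemma.
\<close>

lemma has_sum_integral: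
  fixes f :: "int \<Rightarrow> 'a \<Rightarrow> complex"
  assumes int: "\<And>j. integrable M (f j)"
    and bound: "\<And>j. (\<integral>x. norm (f j x) \<partial>M) \<le> B j" and B: "B summable_on UNIV"
    and S: "\<And>x. x \<in> space M \<Longrightarrow> ((\<lambda>j. f j x) has_sum S x) UNIV"
  shows "((\<lambda>j. \<integral>x. f j x \<partial>M) has_sum (\<integral>x. S x \<partial>M)) UNIV"
proof -
  define d where "d = int_decode"
  have bij: "bij_betw d UNIV UNIV" unfolding d_def by (rule bij_int_decode)
  define g where "g = (\<lambda>n. f (d n))"
  have sums: "(\<lambda>n. g n x) sums S x" "summable (\<lambda>n. norm (g n x))" if "x \<in> space M" for x
  proof -
    have "((\<lambda>n. g n x) has_sum S x) UNIV"
      unfolding g_def has_sum_reindex_bij_betw[OF bij, of "\<lambda>j. f j x"] by (rule S[OF that])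
    then show "(\<lambda>n. g n x) sums S x" "summable (\<lambda>n. norm (g n x))"
      by (auto intro: has_sum_imp_sums summable_on_imp_summable has_sum_imp_abs_summable)
  qed
  have "(\<lambda>n. B (d n)) summable_on UNIV"
    using B summable_on_reindex_bij_betw[OF bij, of B] by simp
  then have "summable (\<lambda>n. B (d n))" by (rule summable_on_imp_summable)
  then have sn: "summable (\<lambda>n. \<integral>x. norm (g n x) \<partial>M)"
    by (rule summable_comparison_test'[where N=0]) (simp add: g_def bound)
  have "(\<lambda>n. \<integral>x. g n x \<partial>M) sums (\<integral>x. (\<Sum>n. g n x) \<partial>M)"
    by (rule sums_integral) (use int sums sn in \<open>auto simp: g_def\<close>)
  also have "(\<integral>x. (\<Sum>n. g n x) \<partial>M) = (\<integral>x. S x \<partial>M)"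
    using sums by (intro Bochner_Integration.integral_cong) (auto simp: sums_iff)
  finally have "(\<lambda>n. \<integral>x. g n x \<partial>M) sums (\<integral>x. S x \<partial>M)" .
  moreover have "summable (\<lambda>n. norm (\<integral>x. g n x \<partial>M))"
    by (rule summable_comparison_test'[OF sn, where N=0]) simp
  ultimately have "((\<lambda>n. \<integral>x. g n x \<partial>M) has_sum (\<integral>x. S x \<partial>M)) UNIV"
    by (intro norm_summable_imp_has_sum)
  then show ?thesis
    unfolding g_def has_sum_reindex_bij_betw[OF bij, of "\<lambda>j. \<integral>x. f j x \<partial>M"] .
qed

section \<open>Gaussian sums\<close>

lemma half_gaussian_integral:
  assumes "s > 0"
  shows "has_bochner_integral lborel (\<lambda>x. indicator {0..} x * exp (- (s * x\<^sup>2))) (sqrt (pi / s) / 2)"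
proof -
  have "has_bochner_integral lborel
      (\<lambda>x. indicator {0..} (0 + sqrt s * x) *\<^sub>R exp (- (0 + sqrt s * x)\<^sup>2)) ((sqrt pi / 2) /\<^sub>R \<bar>sqrt s\<bar>)"
    using gaussian_moment_0 assms
    by (subst lborel_has_bochner_integral_real_affine_iff[symmetric]) auto
  moreover have "indicator {0..} (0 + sqrt s * x) *\<^sub>R exp (- (0 + sqrt s * x)\<^sup>2)
      = indicator {0..} x * exp (- (s * x\<^sup>2))" for x :: real
    using assms by (simp add: indicator_def power_mult_distrib zero_le_mult_iff)
  ultimately show ?thesis using assms by (simp add: real_sqrt_divide divide_simps mult_ac)
qed

text \<open>
  The summand with index \<open>n\<close> is the value at the right end of \<open>[n, n+1)\<close> of a function
  decreasing on the half line, so the sum is a lower Riemann sum of the Gaussian integral.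
\<close>

lemma sum_gaussian_le:
  assumes "s > 0"
  shows "(\<Sum>n<N. exp (- (s * (real n + 1)\<^sup>2))) \<le> sqrt (pi / s) / 2"
proof -
  note G = half_gaussian_integral[OF assms]
  define c where "c = (\<lambda>n. exp (- (s * (real n + 1)\<^sup>2)))"
  have "(\<Sum>n<N. c n) = (\<Sum>n<N. \<integral>x. c n * indicator {real n..<real n + 1} x \<partial>lborel)"
    by simp
  also have "\<dots> = (\<integral>x. (\<Sum>n<N. c n * indicator {real n..<real n + 1} x) \<partial>lborel)"
    by (subst Bochner_Integration.integral_sum) auto
  also have "\<dots> \<le> (\<integral>x. indicator {0..} x * exp (- (s * x\<^sup>2)) \<partial>lborel)"
  proof (rule integral_mono)
    show "integrable lborel (\<lambda>x. \<Sum>n<N. c n * indicator {real n..<real n + 1} x)"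
      by (intro Bochner_Integration.integrable_sum integrable_mult_right integrable_real_indicator) auto
    show "integrable lborel (\<lambda>x. indicator {0..} x * exp (- (s * x\<^sup>2)))"
      using G by (rule integrable.intros)
    fix x :: real
    show "(\<Sum>n<N. c n * indicator {real n..<real n + 1} x) \<le> indicator {0..} x * exp (- (s * x\<^sup>2))"
    proof (cases "x \<ge> 0")
      case True
      have ind: "indicator {real n..<real n + 1} x = (if n = nat \<lfloor>x\<rfloor> then 1 else (0::real))" for n
      proof -
        have "x \<in> {real n..<real n + 1} \<longleftrightarrow> n = nat \<lfloor>x\<rfloor>"
          using True by (auto simp: floor_eq_iff intro!: nat_eq_iff[THEN iffD2] ) linarith+
        then show ?thesis by (simp add: indicator_def)
      qed
      have "(\<Sum>n<N. c n * indicator {real n..<real n + 1} x)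
          = (if nat \<lfloor>x\<rfloor> < N then c (nat \<lfloor>x\<rfloor>) else 0)"
      proof -
        have "(\<Sum>n<N. c n * indicator {real n..<real n + 1} x)
            = (\<Sum>n<N. if n = nat \<lfloor>x\<rfloor> then c n else 0)"
          by (intro sum.cong refl) (simp add: ind)
        then show ?thesis by simp
      qed
      also have "\<dots> \<le> c (nat \<lfloor>x\<rfloor>)" by (simp add: c_def)
      also have "\<dots> \<le> exp (- (s * x\<^sup>2))"
      proof -
        have "x \<le> real (nat \<lfloor>x\<rfloor>) + 1" using True by linarith
        then have "x\<^sup>2 \<le> (real (nat \<lfloor>x\<rfloor>) + 1)\<^sup>2" using True by (rule power_mono)
        then show ?thesis unfolding c_def using assms by simp
      qed
      finally show ?thesis using True by simp
    next
      case False
      then have "indicator {real n..<real n + 1} x = (0::real)" for n by (simp add: indicator_def)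
      then show ?thesis using False by simp
    qed
  qed
  also have "\<dots> = sqrt (pi / s) / 2" using G by (rule has_bochner_integral_integral_eq)
  finally show ?thesis by (simp add: c_def)
qed

text \<open>
  Leaving out index 0 is essential: the sum over all integers exceeds the Gaussian integral
  \<open>sqrt (\<pi> / s)\<close>, since by Poisson summation it is that integral times
  a series of positive terms, one of which is 1.
\<close>

lemma sum_gaussian_nonzero_le:
  assumes "s > 0" "finite F" "0 \<notin> F"
  shows "(\<Sum>j\<in>F. exp (- (s * (of_int j)\<^sup>2))) \<le> sqrt (pi / s)"
proof -
  define N where "N = nat (Max (insert 0 (abs ` F)))"
  define p q where "p = (\<lambda>n::nat. int n + 1)" and "q = (\<lambda>n::nat. - int n - 1)"
  define h where "h = (\<lambda>j::int. exp (- (s * (of_int j)\<^sup>2)))"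
  have "F \<subseteq> p ` {..<N} \<union> q ` {..<N}"
  proof
    fix j assume j: "j \<in> F"
    have "\<bar>j\<bar> \<le> Max (insert 0 (abs ` F))" using assms j by (intro Max_ge) auto
    moreover have "j \<noteq> 0" using assms j by auto
    ultimately have "j = p (nat (j - 1)) \<and> nat (j - 1) < N \<or> j = q (nat (- j - 1)) \<and> nat (- j - 1) < N"
      unfolding p_def q_def N_def by linarith
    then show "j \<in> p ` {..<N} \<union> q ` {..<N}" by blast
  qed
  then have "sum h F \<le> sum h (p ` {..<N} \<union> q ` {..<N})"
    by (intro sum_mono2) (auto simp: h_def)
  also have "\<dots> = sum h (p ` {..<N}) + sum h (q ` {..<N})"
    by (intro sum.union_disjoint) (auto simp: p_def q_def)
  also have "\<dots> = (\<Sum>n<N. h (p n)) + (\<Sum>n<N. h (q n))"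
    by (simp add: sum.reindex inj_on_def p_def q_def)
  also have "\<dots> = 2 * (\<Sum>n<N. exp (- (s * (real n + 1)\<^sup>2)))"
  proof -
    have "h (q n) = exp (- (s * (real n + 1)\<^sup>2))" for n
      by (simp add: h_def q_def power2_eq_square algebra_simps)
    moreover have "h (p n) = exp (- (s * (real n + 1)\<^sup>2))" for n
      by (simp add: h_def p_def)
    ultimately show ?thesis by simp
  qed
  also have "\<dots> \<le> sqrt (pi / s)" using sum_gaussian_le[OF assms(1), of N] by simp
  finally show ?thesis by (simp add: h_def)
qed

lemma summable_gaussian:
  fixes s :: real
  assumes "s > 0"
  shows "(\<lambda>j::int. exp (- (s * (of_int j)\<^sup>2))) summable_on A"
proof (rule summable_on_subset_banach)
  show "(\<lambda>j::int. exp (- (s * (of_int j)\<^sup>2))) summable_on UNIV"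
  proof (rule nonneg_bdd_above_summable_on)
    show "bdd_above (sum (\<lambda>j::int. exp (- (s * (of_int j)\<^sup>2))) ` {F. F \<subseteq> UNIV \<and> finite F})"
    proof (rule bdd_aboveI2)
      fix F :: "int set" assume "F \<in> {F. F \<subseteq> UNIV \<and> finite F}"
      then have fin: "finite F" by simp
      have "(\<Sum>j\<in>F. exp (- (s * (of_int j)\<^sup>2))) \<le> (\<Sum>j\<in>insert 0 F. exp (- (s * (of_int j)\<^sup>2)))"
        using fin by (intro sum_mono2) auto
      also have "\<dots> = 1 + (\<Sum>j\<in>F - {0}. exp (- (s * (of_int j)\<^sup>2)))"
        using fin by (subst sum.insert_remove) auto
      also have "\<dots> \<le> 1 + sqrt (pi / s)"
        using sum_gaussian_nonzero_le[OF assms, of "F - {0}"] fin by auto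
      finally show "(\<Sum>j\<in>F. exp (- (s * (of_int j)\<^sup>2))) \<le> 1 + sqrt (pi / s)" .
    qed
  qed simp
qed simp

text \<open>
  From \<open>\<bar>j\<bar> = k + \<bar>t\<bar>\<close> follows \<open>j\<^sup>2 \<ge> k\<^sup>2 + t\<^sup>2\<close>: moving both halves of the tail inwards by
  \<open>k\<close> extracts the factor \<open>exp (- s k\<^sup>2)\<close> and leaves a sum over nonzero integers.
\<close>

lemma sum_gaussian_tail_le:
  assumes "s > 0" "finite F" "F \<subseteq> {j. \<bar>j\<bar> > int k}"
  shows "(\<Sum>j\<in>F. exp (- (s * (of_int j)\<^sup>2))) \<le> exp (- (s * (real k)\<^sup>2)) * sqrt (pi / s)"
proof -
  define t where "t = (\<lambda>j. j - sgn j * int k)"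
  have t: "t j \<noteq> 0" "(real_of_int j)\<^sup>2 \<ge> (real k)\<^sup>2 + (of_int (t j))\<^sup>2" if "j \<in> F" for j
  proof -
    have j: "\<bar>j\<bar> > int k" using assms that by auto
    then show "t j \<noteq> 0" by (auto simp: t_def sgn_if split: if_splits)
    have "\<bar>t j\<bar> = \<bar>j\<bar> - int k" using j by (auto simp: t_def sgn_if)
    then have *: "\<bar>j\<bar> = int k + \<bar>t j\<bar>" by simp
    have "(real_of_int j)\<^sup>2 = (of_int \<bar>j\<bar>)\<^sup>2" by simp
    also have "\<dots> = (real k + of_int \<bar>t j\<bar>)\<^sup>2" unfolding * by simp
    also have "\<dots> \<ge> (real k)\<^sup>2 + (of_int \<bar>t j\<bar>)\<^sup>2"
      unfolding power2_sum by (simp only: le_add_same_cancel1) simp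
    finally show "(real_of_int j)\<^sup>2 \<ge> (real k)\<^sup>2 + (of_int (t j))\<^sup>2" by simp
  qed
  have inj: "inj_on t F"
  proof (rule inj_onI)
    fix i j assume "i \<in> F" "j \<in> F" and eq: "t i = t j"
    then have "\<bar>i\<bar> > int k" "\<bar>j\<bar> > int k" using assms by auto
    then show "i = j" using eq by (auto simp: t_def sgn_if split: if_splits)
  qed
  have "(\<Sum>j\<in>F. exp (- (s * (of_int j)\<^sup>2)))
      \<le> (\<Sum>j\<in>F. exp (- (s * (real k)\<^sup>2)) * exp (- (s * (of_int (t j))\<^sup>2)))"
  proof (rule sum_mono)
    fix j assume "j \<in> F"
    then have "s * ((real k)\<^sup>2 + (of_int (t j))\<^sup>2) \<le> s * (real_of_int j)\<^sup>2"
      using t assms(1) by (intro mult_left_mono) auto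
    then show "exp (- (s * (of_int j)\<^sup>2)) \<le> exp (- (s * (real k)\<^sup>2)) * exp (- (s * (of_int (t j))\<^sup>2))"
      by (simp add: exp_add[symmetric] algebra_simps)
  qed
  also have "\<dots> = exp (- (s * (real k)\<^sup>2)) * (\<Sum>j\<in>t ` F. exp (- (s * (of_int j)\<^sup>2)))"
    by (simp add: sum.reindex[OF inj] sum_distrib_left)
  also have "\<dots> \<le> exp (- (s * (real k)\<^sup>2)) * sqrt (pi / s)"
    using sum_gaussian_nonzero_le[OF assms(1), of "t ` F"] assms t(1)
    by (intro mult_left_mono) force+
  finally show ?thesis .
qed

section \<open>The periodised Gaussian\<close>

definition gauss_multiplier :: "real \<Rightarrow> int \<Rightarrow> real" where
  "gauss_multiplier \<sigma> l = exp (- (\<sigma>\<^sup>2 * pi\<^sup>2 * (of_int l)\<^sup>2 / 2))"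

definition theta :: "real \<Rightarrow> real \<Rightarrow> real" where
  "theta \<sigma> x = (\<Sum>\<^sub>\<infinity>j::int. gauss \<sigma> (x + 2 * of_int j))"

lemma gauss_multiplier_pos: "gauss_multiplier \<sigma> l > 0"
  and gauss_multiplier_uminus: "gauss_multiplier \<sigma> (- l) = gauss_multiplier \<sigma> l"
  and gauss_multiplier_0 [simp]: "gauss_multiplier \<sigma> 0 = 1"
  by (simp_all add: gauss_multiplier_def)

lemma summable_gauss_multiplier:
  assumes "\<sigma> > 0" shows "gauss_multiplier \<sigma> summable_on A"
  using summable_gaussian[of "\<sigma>\<^sup>2 * pi\<^sup>2 / 2" A] assms
  by (simp add: gauss_multiplier_def[abs_def] mult_ac)

lemma continuous_on_infsum:
  fixes f :: "'i \<Rightarrow> real \<Rightarrow> 'a::banach"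
  assumes "\<And>j. continuous_on A (f j)" "\<And>j x. x \<in> A \<Longrightarrow> norm (f j x) \<le> M j" "M summable_on UNIV"
  shows "continuous_on A (\<lambda>x. \<Sum>\<^sub>\<infinity>j. f j x)"
proof -
  have "uniform_limit A (\<lambda>X x. \<Sum>j\<in>X. f j x) (\<lambda>x. \<Sum>\<^sub>\<infinity>j. f j x) (finite_subsets_at_top UNIV)"
    by (rule Weierstrass_m_test_general[where M=M]) (use assms in auto)
  then show ?thesis
    by (rule uniform_limit_theorem[rotated])
       (auto intro!: always_eventually continuous_on_sum assms)
qed

text \<open>
  A majorant that does not depend on \<open>x\<close> in a bounded set, from \<open>(x + 2 j)\<^sup>2 \<ge> 2 j\<^sup>2 - x\<^sup>2\<close>. It
  makes the series over the translates uniformly convergent.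
\<close>

lemma gauss_shift_le:
  assumes "\<sigma> > 0" "\<bar>x\<bar> \<le> R"
  shows "gauss \<sigma> (x + 2 * of_int j)
    \<le> exp (R\<^sup>2 / (2 * \<sigma>\<^sup>2)) / sqrt (2 * pi * \<sigma>\<^sup>2) * exp (- (1 / \<sigma>\<^sup>2 * (of_int j)\<^sup>2))"
proof -
  have "2 * (of_int j)\<^sup>2 - x\<^sup>2 \<le> (x + 2 * of_int j)\<^sup>2"
    using zero_le_power2[of "x + of_int j"] by (simp add: power2_eq_square algebra_simps)
  moreover have "x\<^sup>2 \<le> R\<^sup>2" using power_mono[OF assms(2), of 2] by simp
  ultimately have "2 * (of_int j)\<^sup>2 - R\<^sup>2 \<le> (x + 2 * of_int j)\<^sup>2" by linarith
  then have "- ((x + 2 * of_int j)\<^sup>2 / (2 * \<sigma>\<^sup>2)) \<le> - ((2 * (of_int j)\<^sup>2 - R\<^sup>2) / (2 * \<sigma>\<^sup>2))"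
    using assms(1) by (simp add: divide_right_mono)
  also have "\<dots> = R\<^sup>2 / (2 * \<sigma>\<^sup>2) - 1 / \<sigma>\<^sup>2 * (of_int j)\<^sup>2"
    using assms(1) by (simp add: field_simps)
  finally have "exp (- ((x + 2 * of_int j)\<^sup>2 / (2 * \<sigma>\<^sup>2)))
      \<le> exp (R\<^sup>2 / (2 * \<sigma>\<^sup>2)) * exp (- (1 / \<sigma>\<^sup>2 * (of_int j)\<^sup>2))"
    by (simp add: exp_add[symmetric])
  then show ?thesis
    unfolding normal_density_def by (simp add: divide_right_mono)
qed

lemma summable_gauss_bound:
  "\<sigma> > 0 \<Longrightarrow> (\<lambda>j::int. c * exp (- (1 / \<sigma>\<^sup>2 * (of_int j)\<^sup>2 :: real))) summable_on UNIV"
  by (intro summable_on_cmult_right summable_gaussian) simp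

lemma theta_has_sum:
  assumes "\<sigma> > 0"
  shows "((\<lambda>j. gauss \<sigma> (x + 2 * of_int j)) has_sum theta \<sigma> x) UNIV"
  unfolding theta_def
  by (rule has_sum_infsum, rule summable_on_comparison_test[OF summable_gauss_bound[OF assms]])
     (rule gauss_shift_le[OF assms order_refl], simp)

lemma theta_uminus: "theta \<sigma> (- x) = theta \<sigma> x"
proof -
  have "gauss \<sigma> (- x + 2 * of_int (- j)) = gauss \<sigma> (x + 2 * of_int j)" for j
    by (simp add: normal_density_def power2_eq_square algebra_simps)
  then show ?thesis
    unfolding theta_def
    using infsum_reindex_bij_betw[OF bij_uminus, of "\<lambda>j::int. gauss \<sigma> (- x + 2 * of_int j)"] by simp
qed

lemma theta_periodic: "theta \<sigma> (x + 2 * of_int n) = theta \<sigma> x"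
proof -
  have "bij (\<lambda>j::int. j + n)" by (rule bij_plus_right)
  from infsum_reindex_bij_betw[OF this, of "\<lambda>j::int. gauss \<sigma> (x + 2 * of_int j)"]
  show ?thesis unfolding theta_def by (simp add: algebra_simps)
qed

lemma continuous_on_theta:
  assumes "\<sigma> > 0"
  shows "continuous_on {-1..1} (theta \<sigma>)"
  unfolding theta_def[abs_def]
proof (rule continuous_on_infsum[OF _ _ summable_gauss_bound[OF assms]])
  show "continuous_on {-1..1} (\<lambda>x. gauss \<sigma> (x + 2 * of_int j))" for j
    unfolding normal_density_def using assms by (intro continuous_intros) auto
  fix j :: int and x :: real assume "x \<in> {-1..1}"
  then have "\<bar>x\<bar> \<le> 1" by auto
  from gauss_shift_le[OF assms this]
  show "norm (gauss \<sigma> (x + 2 * of_int j))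
    \<le> exp (1\<^sup>2 / (2 * \<sigma>\<^sup>2)) / sqrt (2 * pi * \<sigma>\<^sup>2) * exp (- (1 / \<sigma>\<^sup>2 * (of_int j)\<^sup>2))" by simp
qed

text \<open>
  After rescaling, this is the characteristic function of the standard normal distribution.
\<close>

lemma gauss_fourier_transform:
  assumes "\<sigma> > 0"
  shows "(\<integral>x. of_real (gauss \<sigma> x) * fourier_basis (- l) x \<partial>lborel) = of_real (gauss_multiplier \<sigma> l)"
proof -
  define t where "t = - (of_int l * pi * \<sigma>)"
  have "(\<integral>x. of_real (gauss \<sigma> x) * fourier_basis (- l) x \<partial>lborel)
      = \<bar>\<sigma>\<bar> *\<^sub>R (\<integral>x. of_real (gauss \<sigma> (0 + \<sigma> * x)) * fourier_basis (- l) (0 + \<sigma> * x) \<partial>lborel)"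
    by (rule lborel_integral_real_affine) (use assms in simp)
  also have "\<dots> = (\<integral>x. \<bar>\<sigma>\<bar> *\<^sub>R (of_real (gauss \<sigma> (0 + \<sigma> * x)) * fourier_basis (- l) (0 + \<sigma> * x)) \<partial>lborel)"
    by (rule integral_scaleR_right[symmetric])
  also have "\<dots> = (\<integral>x. std_normal_density x *\<^sub>R iexp (t * x) \<partial>lborel)"
  proof (intro Bochner_Integration.integral_cong refl)
    fix x :: real
    have "\<sigma> * gauss \<sigma> (\<sigma> * x) = std_normal_density x"
      using assms by (simp add: normal_density_def real_sqrt_mult power_mult_distrib field_simps)
    moreover have "fourier_basis (- l) (\<sigma> * x) = iexp (t * x)"
      by (simp add: fourier_basis_eq_cis cis_conv_exp t_def mult_ac)
    ultimately show "\<bar>\<sigma>\<bar> *\<^sub>R (of_real (gauss \<sigma> (0 + \<sigma> * x)) * fourier_basis (- l) (0 + \<sigma> * x))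
        = std_normal_density x *\<^sub>R iexp (t * x)"
      using assms by (simp add: scaleR_conv_of_real flip: of_real_mult mult.assoc)
  qed
  also have "\<dots> = char std_normal_distribution t"
    unfolding char_def by (subst integral_density) auto
  also have "\<dots> = of_real (gauss_multiplier \<sigma> l)"
    by (simp add: char_std_normal_distribution gauss_multiplier_def t_def power_mult_distrib mult_ac)
  finally show ?thesis .
qed

text \<open>
  The half-open interval is chosen because its translates by even integers partition the real
  line.
\<close>

lemma integral_m_eq_lborel:
  fixes f :: "real \<Rightarrow> 'a::{banach, second_countable_topology}"
  assumes [measurable]: "f \<in> borel_measurable borel"
  shows "(\<integral>x. f x \<partial>m) = (\<integral>x. indicator {-1..<1} x *\<^sub>R f x \<partial>lborel)"
proof -
  have "(\<integral>x. f x \<partial>m) = (\<integral>x. indicator {-1..1} x *\<^sub>R f x \<partial>lebesgue)"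
    by (rule integral_restrict_space) simp
  also have "\<dots> = (\<integral>x. indicator {-1..1} x *\<^sub>R f x \<partial>lborel)"
    by (rule integral_completion) measurable
  also have "\<dots> = (\<integral>x. indicator {-1..<1} x *\<^sub>R f x \<partial>lborel)"
  proof (rule integral_cong_AE)
    show "AE x in lborel. indicator {-1..1} x *\<^sub>R f x = indicator {-1..<1} x *\<^sub>R f x"
      using AE_lborel_singleton[of 1] by eventually_elim (auto simp: indicator_def)
  qed measurable
  finally show ?thesis .
qed

text \<open>
  Unfolding: the integral over one period of the sum over all translates is the integral over
  the whole line, since \<open>e\<^sub>-\<^sub>l\<close> has period 2.
\<close>

lemma theta_fourier_coeff:
  assumes "\<sigma> > 0"
  shows "(\<integral>x. of_real (theta \<sigma> x) * fourier_basis (- l) x \<partial>m) = of_real (gauss_multiplier \<sigma> l)"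
proof -
  define f where "f = (\<lambda>j x. complex_of_real (gauss \<sigma> (x + 2 * of_int j)) * fourier_basis (- l) x)"
  define g where "g = (\<lambda>(j::int) x. indicator {2 * of_int j - 1..<2 * of_int j + 1} x *\<^sub>R
      (complex_of_real (gauss \<sigma> x) * fourier_basis (- l) x))"
  define B where "B = (\<lambda>j::int. 2 * (exp (1\<^sup>2 / (2 * \<sigma>\<^sup>2)) / sqrt (2 * pi * \<sigma>\<^sup>2) * exp (- (1 / \<sigma>\<^sup>2 * (of_int j)\<^sup>2))))"
  have B: "B summable_on UNIV"
    unfolding B_def by (intro summable_on_cmult_right summable_gaussian) (use assms in simp)
  have f_meas [measurable]: "f j \<in> borel_measurable borel" for j unfolding f_def by measurable
  have f_meas_m [measurable]: "f j \<in> borel_measurable m" for j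
    by (intro measurable_restrict_space1 measurable_completion) simp
  have norm_f: "norm (f j x) \<le> B j / 2" if "x \<in> {-1..1}" for j x
    using gauss_shift_le[OF assms, of x 1 j] that by (simp add: f_def B_def norm_mult abs_le_iff)
  have int_f: "integrable m (f j)" for j
    using norm_f by (intro bounded_imp_integrable_m[where B="B j / 2"]) auto
  have norm_int_f: "(\<integral>x. norm (f j x) \<partial>m) \<le> B j" for j
  proof -
    have "(\<integral>x. norm (f j x) \<partial>m) \<le> (\<integral>x. B j / 2 \<partial>m)"
      using int_f norm_f by (intro integral_mono) auto
    then show ?thesis unfolding integral_const_m by simp
  qed
  \<comment> \<open>Used twice: \<open>h\<close> is the norm for the domination and the identity for the values.\<close>
  have shift: "(\<integral>x. h (f j x) \<partial>m) = (\<integral>x. h (g j x) \<partial>lborel)"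
    if [measurable]: "h \<in> borel_measurable borel" and h0: "h 0 = 0"
    for j and h :: "complex \<Rightarrow> 'b::{banach, second_countable_topology}"
  proof -
    have "(\<integral>x. h (f j x) \<partial>m) = (\<integral>x. indicator {-1..<1} x *\<^sub>R h (f j x) \<partial>lborel)"
      by (rule integral_m_eq_lborel) measurable
    also have "\<dots> = (\<integral>x. h (g j (2 * of_int j + 1 * x)) \<partial>lborel)"
    proof (intro Bochner_Integration.integral_cong refl)
      fix x :: real
      have "fourier_basis (- l) (2 * of_int j + x) = fourier_basis (- l) x"
        by (simp add: fourier_basis_add)
      then show "indicator {-1..<1} x *\<^sub>R h (f j x) = h (g j (2 * of_int j + 1 * x))"
        by (auto simp: f_def g_def indicator_def h0 add.commute)
    qed
    also have "\<dots> = (\<integral>x. h (g j x) \<partial>lborel)"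
      using lborel_integral_real_affine[of 1 "\<lambda>x. h (g j x)" "2 * of_int j"] by simp
    finally show ?thesis .
  qed
  have "((\<lambda>j. \<integral>x. f j x \<partial>m) has_sum (\<integral>x. of_real (theta \<sigma> x) * fourier_basis (- l) x \<partial>m)) UNIV"
  proof (rule has_sum_integral[OF int_f norm_int_f B])
    show "((\<lambda>j. f j x) has_sum of_real (theta \<sigma> x) * fourier_basis (- l) x) UNIV" for x
      unfolding f_def by (intro has_sum_cmult_left has_sum_of_real theta_has_sum assms)
  qed
  moreover have "((\<lambda>j. \<integral>x. g j x \<partial>lborel) has_sum
      (\<integral>x. of_real (gauss \<sigma> x) * fourier_basis (- l) x \<partial>lborel)) UNIV"
  proof (rule has_sum_integral[OF _ _ B])
    show "integrable lborel (g j)" for j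
    proof -
      have "integrable lborel (\<lambda>x. gauss \<sigma> x)" using assms by simp
      then show ?thesis
        by (rule Bochner_Integration.integrable_bound)
           (auto simp: g_def norm_mult indicator_def)
    qed
    show "(\<integral>x. norm (g j x) \<partial>lborel) \<le> B j" for j
      using norm_int_f[of j] shift[of norm j] by simp
    show "((\<lambda>j. g j x) has_sum of_real (gauss \<sigma> x) * fourier_basis (- l) x) UNIV" for x
      \<comment> \<open>Exactly one of the half-open intervals contains \<open>x\<close>.\<close>
    proof (rule has_sum_finite_neutralI[of "{\<lfloor>(x + 1) / 2\<rfloor>}"])
      have iff: "x \<in> {2 * of_int j - 1..<2 * of_int j + 1} \<longleftrightarrow> j = \<lfloor>(x + 1) / 2\<rfloor>" for j
        by (auto simp: eq_commute[of j] floor_eq_iff field_simps)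
      show "g j x = 0" if "j \<in> UNIV - {\<lfloor>(x + 1) / 2\<rfloor>}" for j
        using that iff[of j] by (simp add: g_def)
      show "of_real (gauss \<sigma> x) * fourier_basis (- l) x = (\<Sum>j\<in>{\<lfloor>(x + 1) / 2\<rfloor>}. g j x)"
        using iff by (simp add: g_def)
    qed auto
  qed
  moreover have "(\<integral>x. f j x \<partial>m) = (\<integral>x. g j x \<partial>lborel)" for j
    by (rule shift[of "\<lambda>z. z"]) auto
  ultimately show ?thesis
    using has_sum_unique gauss_fourier_transform[OF assms] by auto
qed

section \<open>Poisson summation for the Gaussian\<close>

text \<open>
  Completeness of the Fourier basis, for even functions only. An even function on \<open>[-1, 1]\<close> is
  a function of \<open>cos (\<pi> x)\<close>, so Weierstrass approximation by polynomials in one variable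
  suffices. The powers of \<open>cos (\<pi> x)\<close> are trigonometric polynomials, hence \<open>R\<close> is orthogonal to
  its own approximants and \<open>\<integral> R\<^sup>2\<close> is arbitrarily small.
\<close>

lemma even_orthogonal_imp_zero:
  fixes R :: "real \<Rightarrow> real"
  assumes cont: "continuous_on {-1..1} R" and even: "\<And>x. R (- x) = R x"
    and orth: "\<And>l. (\<integral>x. of_real (R x) * fourier_basis l x \<partial>m) = 0"
    and x: "x \<in> {-1..1}"
  shows "R x = 0"
proof -
  have int: "integrable m (\<lambda>x. f x * R x)" if "continuous_on {-1..1} f" for f :: "real \<Rightarrow> real"
    by (intro continuous_imp_integrable_real continuous_intros cont that)
  have int_c: "integrable m (\<lambda>x. of_real (R x * cos (pi * x) ^ n) * fourier_basis l x)" for n l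
    by (intro continuous_imp_integrable_real continuous_intros cont continuous_fourier_basis)
  have cos_power: "(\<integral>x. of_real (R x * cos (pi * x) ^ n) * fourier_basis l x \<partial>m) = 0" for n l
  proof (induction n arbitrary: l)
    case 0
    then show ?case using orth by simp
  next
    case (Suc n)
    have cos: "complex_of_real (cos (pi * x)) = (fourier_basis 1 x + fourier_basis (- 1) x) / 2" for x
      by (simp add: fourier_basis_eq_cis complex_eq_iff)
    have step: "complex_of_real (R x * cos (pi * x) ^ Suc n) * fourier_basis l x
        = (of_real (R x * cos (pi * x) ^ n) * fourier_basis (l + 1) x
          + of_real (R x * cos (pi * x) ^ n) * fourier_basis (l - 1) x) / 2" for x
    proof -
      have "complex_of_real (R x * cos (pi * x) ^ Suc n) * fourier_basis l x
        = of_real (R x * cos (pi * x) ^ n) * (of_real (cos (pi * x)) * fourier_basis l x)"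
        by simp
      also have "of_real (cos (pi * x)) * fourier_basis l x
          = (fourier_basis (l + 1) x + fourier_basis (l - 1) x) / 2"
        using fourier_basis_mult[of l x 1] fourier_basis_mult[of l x "-1"]
        unfolding cos by (simp add: field_simps)
      finally show ?thesis by (simp add: field_simps)
    qed
    show ?case unfolding step using int_c Suc.IH by simp
  qed
  have poly: "(\<integral>x. p (cos (pi * x)) * R x \<partial>m) = 0" if "real_polynomial_function p" for p
  proof -
    obtain a n where p: "p = (\<lambda>x. \<Sum>i\<le>n. a i * x ^ i)"
      using \<open>real_polynomial_function p\<close> unfolding real_polynomial_function_iff_sum by blast
    have "(\<integral>x. cos (pi * x) ^ i * R x \<partial>m) = 0" for i
    proof -
      have "(\<integral>x. complex_of_real (cos (pi * x) ^ i * R x) \<partial>m) = 0"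
        using cos_power[of i 0] by (simp add: mult.commute)
      then show ?thesis by (subst (asm) integral_complex_of_real) simp
    qed
    moreover have "integrable m (\<lambda>x. cos (pi * x) ^ i * R x)" for i
      by (intro int continuous_intros)
    moreover have "(\<integral>x. p (cos (pi * x)) * R x \<partial>m)
        = (\<integral>x. (\<Sum>i\<le>n. a i * (cos (pi * x) ^ i * R x)) \<partial>m)"
      unfolding p by (simp add: sum_distrib_right mult.assoc)
    ultimately show ?thesis by simp
  qed
  define J where "J = (\<integral>x. \<bar>R x\<bar> \<partial>m)"
  have int_abs: "integrable m (\<lambda>x. \<bar>R x\<bar>)" using int[of "\<lambda>x. 1"] by simp
  have J: "J \<ge> 0" unfolding J_def by (simp add: integral_nonneg_AE)
  have sq: "(\<integral>x. R x * R x \<partial>m) \<le> e * J" if e: "e > 0" for e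
  proof -
    have "(\<lambda>t. arccos t / pi) ` {-1..1} \<subseteq> {-1..1}"
    proof (clarify, rename_tac t)
      fix t :: real assume "t \<in> {-1..1}"
      then have "0 \<le> arccos t" "arccos t \<le> pi" by (auto intro: arccos_lbound arccos_ubound)
      then show "arccos t / pi \<in> {-1..1}" by (auto simp: field_simps intro: order_trans[of _ 0])
    qed
    then have "continuous_on {-1..1} (\<lambda>t. R (arccos t / pi))"
      by (intro continuous_on_compose2[OF cont]) (auto intro!: continuous_intros)
    then obtain p where p: "real_polynomial_function p"
      "\<And>t. t \<in> {-1..1} \<Longrightarrow> \<bar>R (arccos t / pi) - p t\<bar> < e"
      using Stone_Weierstrass_real_polynomial_function[OF compact_Icc _ e] by blast
    have close: "\<bar>R x - p (cos (pi * x))\<bar> < e" if x: "x \<in> {-1..1}" for x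
    proof -
      have "arccos (cos (pi * x)) = pi * \<bar>x\<bar>"
      proof -
        have "cos (pi * x) = cos (pi * \<bar>x\<bar>)" by (simp add: abs_if)
        moreover have "pi * \<bar>x\<bar> \<le> pi * 1" using x by (intro mult_left_mono) auto
        ultimately show ?thesis by (simp add: arccos_cos)
      qed
      then have "R (arccos (cos (pi * x)) / pi) = R x" using even[of x] by (simp add: abs_if)
      then show ?thesis using p(2)[of "cos (pi * x)"] by simp
    qed
    have cp: "continuous_on {-1..1} (\<lambda>x. p (cos (pi * x)))"
    proof -
      have "continuous_on UNIV p"
        using p(1) continuous_on_polymonial_function real_polynomial_function_eq by blast
      then show ?thesis by (rule continuous_on_compose2) (auto intro!: continuous_intros)
    qed
    have "(\<integral>x. R x * R x \<partial>m) = (\<integral>x. R x * R x \<partial>m) - (\<integral>x. p (cos (pi * x)) * R x \<partial>m)"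
      using poly[OF p(1)] by simp
    also have "\<dots> = (\<integral>x. R x * R x - p (cos (pi * x)) * R x \<partial>m)"
      using int[OF cp] int[OF cont] by simp
    also have "\<dots> \<le> (\<integral>x. e * \<bar>R x\<bar> \<partial>m)"
    proof (rule integral_mono)
      show "integrable m (\<lambda>x. R x * R x - p (cos (pi * x)) * R x)"
        using int[OF cp] int[OF cont] by simp
      show "integrable m (\<lambda>x. e * \<bar>R x\<bar>)" using int_abs by simp
      fix x assume "x \<in> space m"
      then have "\<bar>R x - p (cos (pi * x))\<bar> * \<bar>R x\<bar> \<le> e * \<bar>R x\<bar>"
        using close[of x] by (intro mult_right_mono) auto
      moreover have "R x * R x - p (cos (pi * x)) * R x \<le> \<bar>R x - p (cos (pi * x))\<bar> * \<bar>R x\<bar>"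
        by (simp only: left_diff_distrib[symmetric] abs_mult[symmetric] abs_ge_self)
      ultimately show "R x * R x - p (cos (pi * x)) * R x \<le> e * \<bar>R x\<bar>" by linarith
    qed
    also have "\<dots> = e * J" unfolding J_def by (rule integral_mult_right_zero)
    finally show ?thesis .
  qed
  have "(\<integral>x. R x * R x \<partial>m) \<le> 0"
  proof (rule field_le_epsilon)
    fix e :: real assume "e > 0"
    \<comment> \<open>\<open>J + 1\<close> instead of \<open>J\<close>, which may be 0.\<close>
    then have "(\<integral>x. R x * R x \<partial>m) \<le> e / (J + 1) * J" using J by (intro sq) simp
    also have "\<dots> \<le> 0 + e" using J \<open>e > 0\<close> by (simp add: field_simps)
    finally show "(\<integral>x. R x * R x \<partial>m) \<le> 0 + e" .
  qed
  moreover have "0 \<le> (\<integral>x. R x * R x \<partial>m)" by (intro integral_nonneg_AE) simp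
  ultimately have "(\<integral>x. R x * R x \<partial>m) = 0" by (rule antisym)
  then have "integral {-1..1} (\<lambda>x. R x * R x) = 0"
    using lebesgue_integral_eq_integral[OF int[OF cont]] by simp
  then show ?thesis
    using integral_eq_0_iff[of "-1" 1 "\<lambda>x. R x * R x"] x cont by (simp add: continuous_on_mult)
qed

lemma fourier_coeff_of_series:
  fixes c :: "int \<Rightarrow> complex"
  assumes c: "(\<lambda>j. norm (c j)) summable_on UNIV"
    and f: "\<And>x. x \<in> {-1..1} \<Longrightarrow> ((\<lambda>j. c j * fourier_basis j x) has_sum f x) UNIV"
  shows "(\<integral>x. f x * fourier_basis (- l) x \<partial>m) = 2 * c l"
proof -
  have "((\<lambda>j. \<integral>x. c j * fourier_basis (j - l) x \<partial>m) has_sum (\<integral>x. f x * fourier_basis (- l) x \<partial>m)) UNIV"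
  proof (rule has_sum_integral[where B="\<lambda>j. 2 * norm (c j)"])
    show "integrable m (\<lambda>x. c j * fourier_basis (j - l) x)" for j
      by (intro integrable_mult_right integrable_fourier_basis)
    show "(\<integral>x. norm (c j * fourier_basis (j - l) x) \<partial>m) \<le> 2 * norm (c j)" for j
      unfolding norm_mult norm_fourier_basis mult_1_right integral_const_m ..
    show "(\<lambda>j. 2 * norm (c j)) summable_on UNIV" using c by (rule summable_on_cmult_right)
    fix x assume "x \<in> space m"
    then have "((\<lambda>j. c j * fourier_basis j x * fourier_basis (- l) x) has_sum f x * fourier_basis (- l) x) UNIV"
      by (intro has_sum_cmult_left f) simp
    then show "((\<lambda>j. c j * fourier_basis (j - l) x) has_sum f x * fourier_basis (- l) x) UNIV"
      by (simp add: mult.assoc fourier_basis_mult)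
  qed
  moreover have "((\<lambda>j. \<integral>x. c j * fourier_basis (j - l) x \<partial>m) has_sum 2 * c l) UNIV"
    by (rule has_sum_finite_neutralI[of "{l}"]) (auto simp: integral_fourier_basis measure_m scaleR_conv_of_real)
  ultimately show ?thesis by (rule has_sum_unique)
qed

text \<open>
  Both sides are continuous and even with equal Fourier coefficients, so they agree on
  \<open>[-1, 1]\<close>; both have period 2.
\<close>

lemma theta_Poisson:
  assumes "\<sigma> > 0"
  shows "((\<lambda>l. of_real (gauss_multiplier \<sigma> l / 2) * fourier_basis l x) has_sum of_real (theta \<sigma> x)) UNIV"
proof -
  define c where "c = (\<lambda>l. complex_of_real (gauss_multiplier \<sigma> l / 2))"
  define S where "S = (\<lambda>x. \<Sum>\<^sub>\<infinity>l. c l * fourier_basis l x)"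
  have norm_c: "norm (c l) = gauss_multiplier \<sigma> l * (1/2)" for l
    using gauss_multiplier_pos[of \<sigma> l] by (simp add: c_def)
  have c: "(\<lambda>l. norm (c l)) summable_on UNIV"
    unfolding norm_c by (intro summable_on_cmult_left summable_gauss_multiplier assms)
  have S: "((\<lambda>l. c l * fourier_basis l x) has_sum S x) UNIV" for x
    unfolding S_def
    by (rule has_sum_infsum, rule abs_summable_summable) (use c in \<open>simp add: norm_mult\<close>)
  have c_uminus: "c (- l) = c l" for l by (simp add: c_def gauss_multiplier_uminus)
  have S_minus: "S (- x) = S x" for x
    using infsum_reindex_bij_betw[OF bij_uminus, of "\<lambda>l. c l * fourier_basis l x"]
    unfolding S_def by (simp add: c_uminus fourier_basis_neg_arg)
  have S_cnj: "cnj (S x) = S x" for x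
  proof -
    have "cnj (S x) = (\<Sum>\<^sub>\<infinity>l. cnj (c l * fourier_basis l x))" unfolding S_def by (rule infsum_cnj[symmetric])
    also have "\<dots> = S (- x)"
      unfolding S_def by (simp add: c_def fourier_basis_neg_arg fourier_basis_uminus del: infsum_cnj)
    finally show ?thesis using S_minus by simp
  qed
  have S_real: "S x = of_real (Re (S x))" for x
    using S_cnj[of x] by (simp add: complex_eq_iff)
  have S_cont: "continuous_on {-1..1} S"
    unfolding S_def
    by (rule continuous_on_infsum[OF _ _ c])
       (auto intro!: continuous_intros continuous_fourier_basis simp: norm_mult)
  have eq: "theta \<sigma> x = Re (S x)" if "x \<in> {-1..1}" for x
  proof -
    have "theta \<sigma> x - Re (S x) = 0"
    proof (rule even_orthogonal_imp_zero[OF _ _ _ that])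
      show "continuous_on {-1..1} (\<lambda>x. theta \<sigma> x - Re (S x))"
        by (intro continuous_intros continuous_on_theta assms S_cont)
      show "theta \<sigma> (- x) - Re (S (- x)) = theta \<sigma> x - Re (S x)" for x
        by (simp add: theta_uminus S_minus)
      fix l
      have 1: "integrable m (\<lambda>x. of_real (theta \<sigma> x) * fourier_basis l x)"
        by (intro continuous_imp_integrable_real continuous_intros continuous_on_theta assms
            continuous_fourier_basis)
      have 2: "integrable m (\<lambda>x. S x * fourier_basis l x)"
        by (intro continuous_imp_integrable_real continuous_intros S_cont continuous_fourier_basis)
      have "of_real (theta \<sigma> x - Re (S x)) * fourier_basis l x
          = of_real (theta \<sigma> x) * fourier_basis l x - S x * fourier_basis l x" for x
        by (subst S_real) (simp add: left_diff_distrib)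
      then have "(\<integral>x. of_real (theta \<sigma> x - Re (S x)) * fourier_basis l x \<partial>m)
          = (\<integral>x. of_real (theta \<sigma> x) * fourier_basis l x \<partial>m) - (\<integral>x. S x * fourier_basis l x \<partial>m)"
        using Bochner_Integration.integral_diff[OF 1 2] by (simp only:)
      also have "\<dots> = 0"
        using theta_fourier_coeff[OF assms, of "- l"] fourier_coeff_of_series[OF c S, of "- l"]
        by (simp add: c_def gauss_multiplier_uminus)
      finally show "(\<integral>x. of_real (theta \<sigma> x - Re (S x)) * fourier_basis l x \<partial>m) = 0" .
    qed
    then show ?thesis by simp
  qed
  define n where "n = \<lfloor>(x + 1) / 2\<rfloor>"
  have x_mod: "x - 2 * of_int n \<in> {-1..1}"
  proof -
    have "of_int n \<le> (x + 1) / 2" "(x + 1) / 2 < of_int n + 1" unfolding n_def by linarith+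
    then show ?thesis by auto
  qed
  have "theta \<sigma> x = theta \<sigma> (x - 2 * of_int n)"
    using theta_periodic[of \<sigma> "x - 2 * of_int n" n] by simp
  then have "of_real (theta \<sigma> x) = S (x - 2 * of_int n)"
    using eq[OF x_mod] S_real[of "x - 2 * of_int n"] by (simp only:)
  also have "\<dots> = S x"
  proof -
    have "fourier_basis l (x - 2 * of_int n) = fourier_basis l x" for l
      using fourier_basis_add[of l "x - 2 * of_int n" "2 * of_int n"] by simp
    then show ?thesis by (simp add: S_def)
  qed
  finally show ?thesis using S[of x] by (simp only: c_def)
qed

section \<open>The Perron-Frobenius operator\<close>

text \<open>
  Nonsingularity says that the pushforward of \<open>f dm\<close> is absolutely continuous, so that
  Radon-Nikodym applies. The derivative takes values in the extended nonnegative reals and is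
  finite almost everywhere because the pushforward is a finite measure.
\<close>

lemma is_pushforward_density_nonneg:
  fixes f :: "real \<Rightarrow> real"
  assumes T: "nonsingular_map T" and f: "integrable m f" and f0: "\<And>x. f x \<ge> 0"
  shows "\<exists>h. is_pushforward_density T (\<lambda>x. of_real (f x)) h"
proof -
  have T_meas [measurable]: "T \<in> m \<rightarrow>\<^sub>M m"
    and T_null: "\<And>A. A \<in> sets m \<Longrightarrow> emeasure m A = 0 \<Longrightarrow> emeasure m (T -` A \<inter> {-1..1}) = 0"
    using T by (auto simp: nonsingular_map_def)
  have [measurable]: "f \<in> borel_measurable m" using f by simp
  define D where "D = density m (\<lambda>x. ennreal (f x))"
  define N where "N = distr D m T"
  have T_D: "T \<in> D \<rightarrow>\<^sub>M m" unfolding D_def by simp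
  have preimage: "T -` A \<inter> {-1..1} \<in> sets m" if "A \<in> sets m" for A
    using measurable_sets[OF T_meas that] by simp
  have N: "emeasure N A = (\<integral>\<^sup>+x. ennreal (f x) * indicator (T -` A \<inter> {-1..1}) x \<partial>m)"
    if "A \<in> sets m" for A
  proof -
    have "emeasure N A = emeasure D (T -` A \<inter> space D)"
      unfolding N_def by (rule emeasure_distr[OF T_D that])
    also have "T -` A \<inter> space D = T -` A \<inter> {-1..1}" by (simp add: D_def)
    also have "emeasure D \<dots> = (\<integral>\<^sup>+x. ennreal (f x) * indicator (T -` A \<inter> {-1..1}) x \<partial>m)"
      unfolding D_def by (rule emeasure_density) (use preimage[OF that] in auto)
    finally show ?thesis .
  qed
  have sets_N: "sets N = sets m" by (simp add: N_def)
  have "absolutely_continuous m N"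
    unfolding absolutely_continuous_def
  proof
    fix A assume "A \<in> null_sets m"
    then have A: "A \<in> sets m" "emeasure m (T -` A \<inter> {-1..1}) = 0"
      using T_null by auto
    then have null: "T -` A \<inter> {-1..1} \<in> null_sets m" using preimage by auto
    have "emeasure N A = (\<integral>\<^sup>+x. 0 \<partial>m)"
      unfolding N[OF A(1)]
    proof (rule nn_integral_cong_AE)
      show "AE x in m. ennreal (f x) * indicator (T -` A \<inter> {-1..1}) x = 0"
        using AE_not_in[OF null] by eventually_elim simp
    qed
    then show "A \<in> null_sets N" using A sets_N by auto
  qed
  then have dens: "density m (RN_deriv m N) = N"
    using sets_N by (rule m.density_RN_deriv)
  define r where "r = RN_deriv m N"
  define h where "h = (\<lambda>x. enn2real (r x))"
  have r_meas [measurable]: "r \<in> borel_measurable m" unfolding r_def by simp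
  have h_meas [measurable]: "h \<in> borel_measurable m" unfolding h_def by simp
  have r_int: "(\<integral>\<^sup>+x. r x * indicator A x \<partial>m)
      = (\<integral>\<^sup>+x. ennreal (f x) * indicator (T -` A \<inter> {-1..1}) x \<partial>m)" if "A \<in> sets m" for A
    using emeasure_density[OF r_meas that] dens N[OF that] by (simp add: r_def)
  have "(\<integral>\<^sup>+x. r x \<partial>m) \<le> (\<integral>\<^sup>+x. ennreal (f x) \<partial>m)"
  proof -
    have "(\<integral>\<^sup>+x. r x \<partial>m) = (\<integral>\<^sup>+x. r x * indicator (space m) x \<partial>m)"
      by (intro nn_integral_cong) simp
    also have "\<dots> = (\<integral>\<^sup>+x. ennreal (f x) * indicator (T -` space m \<inter> {-1..1}) x \<partial>m)"
      by (rule r_int) (rule sets.top)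
    also have "\<dots> \<le> (\<integral>\<^sup>+x. ennreal (f x) \<partial>m)"
      by (intro nn_integral_mono) (auto simp: indicator_def)
    finally show ?thesis .
  qed
  also have "\<dots> < \<infinity>" using f f0 by (simp add: integrable_iff_bounded)
  finally have r_fin: "(\<integral>\<^sup>+x. r x \<partial>m) < \<infinity>" .
  then have "AE x in m. r x \<noteq> \<infinity>" by (intro nn_integral_PInf_AE) auto
  then have r_h: "AE x in m. ennreal (h x) = r x"
    by eventually_elim (simp add: h_def ennreal_enn2real_if)
  have h0: "h x \<ge> 0" for x by (simp add: h_def)
  have "(\<integral>\<^sup>+x. ennreal (norm (h x)) \<partial>m) = (\<integral>\<^sup>+x. r x \<partial>m)"
    using r_h by (intro nn_integral_cong_AE) (auto simp: h0)
  then have int_h: "integrable m h"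
    using r_fin by (intro integrableI_bounded) auto
  have eq: "(\<integral>x. indicator A x * h x \<partial>m) = (\<integral>x. indicator (T -` A \<inter> {-1..1}) x * f x \<partial>m)"
    if A [measurable]: "A \<in> sets m" for A
  proof -
    note [measurable] = preimage[OF A]
    have "(\<integral>x. indicator A x * h x \<partial>m) = enn2real (\<integral>\<^sup>+x. ennreal (indicator A x * h x) \<partial>m)"
      by (rule integral_eq_nn_integral) (auto simp: h0)
    also have "(\<integral>\<^sup>+x. ennreal (indicator A x * h x) \<partial>m) = (\<integral>\<^sup>+x. r x * indicator A x \<partial>m)"
      using r_h by (intro nn_integral_cong_AE) (auto simp: indicator_def)
    also have "\<dots> = (\<integral>\<^sup>+x. ennreal (f x) * indicator (T -` A \<inter> {-1..1}) x \<partial>m)"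
      by (rule r_int[OF A])
    also have "\<dots> = (\<integral>\<^sup>+x. ennreal (indicator (T -` A \<inter> {-1..1}) x * f x) \<partial>m)"
      by (intro nn_integral_cong) (auto simp: indicator_def)
    also have "enn2real \<dots> = (\<integral>x. indicator (T -` A \<inter> {-1..1}) x * f x \<partial>m)"
      by (rule integral_eq_nn_integral[symmetric]) (auto simp: f0)
    finally show ?thesis .
  qed
  have "is_pushforward_density T (\<lambda>x. of_real (f x)) (\<lambda>x. of_real (h x))"
    unfolding is_pushforward_density_def
  proof (intro conjI ballI)
    show "integrable m (\<lambda>x. complex_of_real (h x))" using int_h by simp
    fix A assume "A \<in> sets m"
    have *: "(LINT x:B|m. complex_of_real (g x)) = of_real (\<integral>x. indicator B x * g x \<partial>m)" for B g
      unfolding set_lebesgue_integral_def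
      by (subst integral_complex_of_real[symmetric]) (simp add: scaleR_conv_of_real)
    show "(LINT x:A|m. complex_of_real (h x)) = (LINT x:T -` A \<inter> {-1..1}|m. complex_of_real (f x))"
      unfolding * eq[OF \<open>A \<in> sets m\<close>] ..
  qed
  then show ?thesis by blast
qed

lemma is_pushforward_density_linear:
  assumes T: "nonsingular_map T" and f: "integrable m f" "integrable m f'"
    and h: "is_pushforward_density T f h" "is_pushforward_density T f' h'"
  shows "is_pushforward_density T (\<lambda>x. f x + c * f' x) (\<lambda>x. h x + c * h' x)"
  unfolding is_pushforward_density_def
proof (intro conjI ballI)
  have int: "integrable m h" "integrable m h'"
    using h by (auto simp: is_pushforward_density_def)
  then show "integrable m (\<lambda>x. h x + c * h' x)" by simp
  fix A assume A: "A \<in> sets m"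
  have B: "T -` A \<inter> {-1..1} \<in> sets m"
    using T measurable_sets[of T m m A] A by (simp add: nonsingular_map_def)
  have lin: "(LINT x:B|m. u x + c * v x) = (LINT x:B|m. u x) + c * (LINT x:B|m. v x)"
    if "B \<in> sets m" "integrable m u" "integrable m v" for B u v
  proof -
    have "set_integrable m B u" "set_integrable m B v"
      unfolding set_integrable_def using that by (auto intro: integrable_mult_indicator)
    then show ?thesis by (subst set_integral_add) auto
  qed
  show "(LINT x:A|m. h x + c * h' x) = (LINT x:T -` A \<inter> {-1..1}|m. f x + c * f' x)"
    using h A B f int by (simp add: lin is_pushforward_density_def)
qed

lemma pushforward_density_exists:
  assumes T: "nonsingular_map T" and f: "integrable m f"
  shows "\<exists>h. is_pushforward_density T f h"
proof -
  define p q u v where "p = (\<lambda>x. max 0 (Re (f x)))" and "q = (\<lambda>x. max 0 (- Re (f x)))"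
    and "u = (\<lambda>x. max 0 (Im (f x)))" and "v = (\<lambda>x. max 0 (- Im (f x)))"
  have int: "integrable m p" "integrable m q" "integrable m u" "integrable m v"
    unfolding p_def q_def u_def v_def using f by (auto intro!: integrable_max)
  have ex: "\<exists>h. is_pushforward_density T (\<lambda>x. of_real (g x)) h" if "g \<in> {p, q, u, v}" for g
    using that int by (intro is_pushforward_density_nonneg[OF T]) (auto simp: p_def q_def u_def v_def)
  obtain hp hq hu hv where h: "is_pushforward_density T (\<lambda>x. of_real (p x)) hp"
      "is_pushforward_density T (\<lambda>x. of_real (q x)) hq"
      "is_pushforward_density T (\<lambda>x. of_real (u x)) hu"
      "is_pushforward_density T (\<lambda>x. of_real (v x)) hv"
    using ex[of p] ex[of q] ex[of u] ex[of v] by auto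
  have int': "integrable m (\<lambda>x. complex_of_real (p x))" "integrable m (\<lambda>x. complex_of_real (q x))"
    "integrable m (\<lambda>x. complex_of_real (u x))" "integrable m (\<lambda>x. complex_of_real (v x))"
    using int by auto
  note d1 = is_pushforward_density_linear[OF T int'(1,2) h(1,2), of "-1"]
  note d2 = is_pushforward_density_linear[OF T _ int'(3) d1 h(3), of \<i>]
  note d3 = is_pushforward_density_linear[OF T _ int'(4) d2 h(4), of "-\<i>"]
  have "(\<lambda>x. complex_of_real (p x) + - 1 * of_real (q x) + \<i> * of_real (u x) + - \<i> * of_real (v x)) = f"
    by (auto simp: fun_eq_iff complex_eq_iff p_def q_def u_def v_def max_def)
  with d3 int' show ?thesis by auto
qed

lemma perron_frobenius_is_density:
  assumes "nonsingular_map T" "integrable m f"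
  shows "is_pushforward_density T f (perron_frobenius T f)"
  unfolding perron_frobenius_def
  using pushforward_density_exists[OF assms] by (rule someI_ex)

text \<open>
  The definition of a pushforward density is the case where \<open>\<phi>\<close> is an indicator function.
  Linearity gives it for simple functions and dominated convergence for bounded ones.
\<close>

lemma pushforward_density_duality:
  assumes T: "nonsingular_map T" and f: "integrable m f" and h: "is_pushforward_density T f h"
    and \<phi> [measurable]: "\<phi> \<in> borel_measurable m" and B: "\<And>x. norm (\<phi> x) \<le> B"
  shows "(\<integral>x. h x * \<phi> x \<partial>m) = (\<integral>x. f x * \<phi> (T x) \<partial>m)"
proof -
  have T_meas [measurable]: "T \<in> m \<rightarrow>\<^sub>M m" using T by (simp add: nonsingular_map_def)
  have T_space: "T x \<in> {-1..1}" if "x \<in> {-1..1}" for x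
    using measurable_space[OF T_meas, of x] that by simp
  have int_h: "integrable m h" using h by (simp add: is_pushforward_density_def)
  have [measurable]: "h \<in> borel_measurable m" "f \<in> borel_measurable m" using int_h f by auto
  obtain s where seq: "(\<forall>i. simple_function m (s i)) \<and> (\<forall>x\<in>space m. (\<lambda>i. s i x) \<longlonglongrightarrow> \<phi> x)
      \<and> (\<forall>i. \<forall>x\<in>space m. dist (s i x) 0 \<le> 2 * dist (\<phi> x) 0)"
    using borel_measurable_implies_sequence_metric[OF \<phi>, of 0] ..
  have s: "simple_function m (s i)" "x \<in> space m \<Longrightarrow> (\<lambda>i. s i x) \<longlonglongrightarrow> \<phi> x"
      "x \<in> space m \<Longrightarrow> norm (s i x) \<le> 2 * norm (\<phi> x)" for i x
    using seq unfolding dist_0_norm[symmetric] dist_commute[of 0] by blast+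
  have [measurable]: "s i \<in> borel_measurable m" for i
    using s(1) by (rule borel_measurable_simple_function)
  have s_bound: "norm (s i x) \<le> 2 * B" if "x \<in> space m" for i x
    using s(3)[OF that, of i] B[of x] by linarith
  have simple: "(\<integral>x. h x * s i x \<partial>m) = (\<integral>x. f x * s i (T x) \<partial>m)" for i
  proof -
    define V where "V = s i ` space m"
    define A where "A = (\<lambda>c. s i -` {c} \<inter> {-1..1})"
    have V: "finite V" unfolding V_def using s(1) by (rule simple_functionD)
    have A: "A c \<in> sets m" for c
      using simple_functionD(2)[OF s(1), of i "{c}"] by (simp add: A_def)
    have A': "T -` A c \<inter> {-1..1} \<in> sets m" for c
      using measurable_sets[OF T_meas A] by simp
    have int_ind: "integrable m (\<lambda>x. c * (indicator E x *\<^sub>R u x))" if "E \<in> sets m" "integrable m u"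
      for c :: complex and E u
      using that by (intro integrable_mult_right integrable_mult_indicator)
    have rep: "s i y = (\<Sum>c\<in>V. c * (if y \<in> A c then 1 else 0))" if "y \<in> {-1..1}" for y
    proof -
      have "(\<Sum>c\<in>V. c * (if y \<in> A c then 1 else 0)) = (\<Sum>c\<in>V. if s i y = c then c else 0)"
        by (intro sum.cong refl) (use that in \<open>auto simp: A_def\<close>)
      also have "\<dots> = s i y" using V that by (simp add: V_def)
      finally show ?thesis by simp
    qed
    have "(\<integral>x. h x * s i x \<partial>m) = (\<integral>x. (\<Sum>c\<in>V. c * (indicator (A c) x *\<^sub>R h x)) \<partial>m)"
    proof (rule Bochner_Integration.integral_cong[OF refl])
      fix x assume "x \<in> space m"
      then have "h x * s i x = h x * (\<Sum>c\<in>V. c * (if x \<in> A c then 1 else 0))" using rep[of x] by simp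
      also have "\<dots> = (\<Sum>c\<in>V. c * (indicator (A c) x *\<^sub>R h x))"
        unfolding sum_distrib_left by (intro sum.cong refl) (simp add: indicator_def)
      finally show "h x * s i x = (\<Sum>c\<in>V. c * (indicator (A c) x *\<^sub>R h x))" .
    qed
    also have "\<dots> = (\<Sum>c\<in>V. c * (LINT x:A c|m. h x))"
      unfolding set_lebesgue_integral_def
      by (subst Bochner_Integration.integral_sum)
         (rule int_ind[OF A int_h], simp only: integral_mult_right_zero)
    also have "\<dots> = (\<Sum>c\<in>V. c * (LINT x:T -` A c \<inter> {-1..1}|m. f x))"
      using h A by (simp add: is_pushforward_density_def)
    also have "\<dots> = (\<integral>x. (\<Sum>c\<in>V. c * (indicator (T -` A c \<inter> {-1..1}) x *\<^sub>R f x)) \<partial>m)"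
      unfolding set_lebesgue_integral_def
      by (subst Bochner_Integration.integral_sum)
         (rule int_ind[OF A' f], simp only: integral_mult_right_zero)
    also have "\<dots> = (\<integral>x. f x * s i (T x) \<partial>m)"
    proof (rule Bochner_Integration.integral_cong[OF refl])
      fix x assume x: "x \<in> space m"
      then have "f x * s i (T x) = f x * (\<Sum>c\<in>V. c * (if T x \<in> A c then 1 else 0))"
        using rep[of "T x"] T_space[of x] by simp
      also have "\<dots> = (\<Sum>c\<in>V. c * (indicator (T -` A c \<inter> {-1..1}) x *\<^sub>R f x))"
        unfolding sum_distrib_left using x by (intro sum.cong refl) (simp add: indicator_def)
      finally show "(\<Sum>c\<in>V. c * (indicator (T -` A c \<inter> {-1..1}) x *\<^sub>R f x)) = f x * s i (T x)" ..
    qed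
    finally show ?thesis .
  qed
  have "(\<lambda>i. \<integral>x. h x * s i x \<partial>m) \<longlonglongrightarrow> (\<integral>x. h x * \<phi> x \<partial>m)"
  proof (rule integral_dominated_convergence[where w="\<lambda>x. norm (h x) * (2 * B)"])
    show "integrable m (\<lambda>x. norm (h x) * (2 * B))" using int_h by simp
    show "AE x in m. (\<lambda>i. h x * s i x) \<longlonglongrightarrow> h x * \<phi> x"
      by (intro AE_I2 tendsto_mult tendsto_const s(2))
    show "AE x in m. norm (h x * s i x) \<le> norm (h x) * (2 * B)" for i
      unfolding norm_mult by (intro AE_I2 mult_left_mono s_bound) auto
  qed measurable
  moreover have "(\<lambda>i. \<integral>x. f x * s i (T x) \<partial>m) \<longlonglongrightarrow> (\<integral>x. f x * \<phi> (T x) \<partial>m)"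
  proof (rule integral_dominated_convergence[where w="\<lambda>x. norm (f x) * (2 * B)"])
    show "integrable m (\<lambda>x. norm (f x) * (2 * B))" using f by simp
    show "AE x in m. (\<lambda>i. f x * s i (T x)) \<longlonglongrightarrow> f x * \<phi> (T x)"
      using T_space by (intro AE_I2 tendsto_mult tendsto_const s(2)) simp
    show "AE x in m. norm (f x * s i (T x)) \<le> norm (f x) * (2 * B)" for i
      unfolding norm_mult using T_space by (intro AE_I2 mult_left_mono s_bound) auto
  qed measurable
  ultimately show ?thesis unfolding simple by (rule LIMSEQ_unique)
qed

text \<open>
  The Fourier coefficients of the Perron-Frobenius image of \<open>u\<close>, written without choosing a
  representative of that image: unlike \<^const>\<open>perron_frobenius\<close>, they are visibly linear in
  \<open>u\<close>.
\<close>

definition transfer_coeff :: "(real \<Rightarrow> real) \<Rightarrow> (real \<Rightarrow> complex) \<Rightarrow> int \<Rightarrow> complex" where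
  "transfer_coeff T u l = 1/2 * (\<integral>x. u x * fourier_basis (- l) (T x) \<partial>m)"

lemma fourier_coeff_perron_frobenius:
  assumes "nonsingular_map T" "integrable m u"
  shows "fourier_coeff (perron_frobenius T u) l = transfer_coeff T u l"
  unfolding fourier_coeff_def transfer_coeff_def
  using pushforward_density_duality[OF assms perron_frobenius_is_density[OF assms],
      where \<phi>="fourier_basis (- l)" and B=1] by simp

lemma integrable_transfer:
  assumes "nonsingular_map T" "integrable m u"
  shows "integrable m (\<lambda>x. u x * fourier_basis l (T x))"
proof (rule Bochner_Integration.integrable_bound[OF assms(2)])
  have "(\<lambda>x. fourier_basis l (T x)) \<in> borel_measurable m"
    by (rule measurable_compose[OF _ fourier_basis_measurable_m])
       (use assms(1) in \<open>simp add: nonsingular_map_def\<close>)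
  then show "(\<lambda>x. u x * fourier_basis l (T x)) \<in> borel_measurable m"
    using assms(2) by (intro borel_measurable_times) auto
qed (simp add: norm_mult)

lemma norm_transfer_coeff_le: "norm (transfer_coeff T u l) \<le> L1_norm m u / 2"
proof -
  have "norm (\<integral>x. u x * fourier_basis (- l) (T x) \<partial>m) \<le> (\<integral>x. norm (u x * fourier_basis (- l) (T x)) \<partial>m)"
    by (rule integral_norm_bound)
  then show ?thesis by (simp add: transfer_coeff_def L1_norm_def norm_mult)
qed

lemma transfer_coeff_diff:
  assumes "nonsingular_map T" "integrable m u" "integrable m v"
  shows "transfer_coeff T (\<lambda>x. u x - v x) l = transfer_coeff T u l - transfer_coeff T v l"
  unfolding transfer_coeff_def
  using Bochner_Integration.integral_diff[OF integrable_transfer[OF assms(1,2), of "- l"]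
      integrable_transfer[OF assms(1,3), of "- l"]]
  by (simp add: left_diff_distrib right_diff_distrib)

lemma transfer_coeff_0: "transfer_coeff T u 0 = 1/2 * (\<integral>x. u x \<partial>m)"
  by (simp add: transfer_coeff_def)

section \<open>Fourier series of the annealed operator\<close>

lemma noise_eq_integral_theta:
  assumes "\<sigma> > 0" "integrable m h"
  shows "noise \<sigma> h x = (\<integral>y. of_real (theta \<sigma> (x - y)) * h y \<partial>m)"
  unfolding noise_def
proof (rule infsumI)
  define c where "c = exp ((\<bar>x\<bar> + 1)\<^sup>2 / (2 * \<sigma>\<^sup>2)) / sqrt (2 * pi * \<sigma>\<^sup>2)"
  define B where "B = (\<lambda>j::int. c * exp (- (1 / \<sigma>\<^sup>2 * (of_int j)\<^sup>2 :: real)))"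
  have bound: "norm (of_real (gauss \<sigma> (x + 2 * of_int j - y)) * h y) \<le> B j * norm (h y)"
    if "y \<in> {-1..1}" for j y
  proof -
    have "\<bar>x - y\<bar> \<le> \<bar>x\<bar> + 1" using that by auto
    from gauss_shift_le[OF assms(1) this, of j]
    have "gauss \<sigma> (x + 2 * of_int j - y) \<le> B j" by (simp add: B_def c_def algebra_simps)
    then show ?thesis unfolding norm_mult by (intro mult_right_mono) auto
  qed
  have meas: "(\<lambda>y. complex_of_real (gauss \<sigma> (x + 2 * of_int j - y))) \<in> borel_measurable m" for j
    by (rule continuous_imp_measurable_m) (use assms(1) in \<open>auto simp: normal_density_def intro!: continuous_intros\<close>)
  have int: "integrable m (\<lambda>y. of_real (gauss \<sigma> (x + 2 * of_int j - y)) * h y)" for j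
  proof (rule Bochner_Integration.integrable_bound)
    show "integrable m (\<lambda>y. B j * norm (h y))" using assms(2) by simp
    show "(\<lambda>y. of_real (gauss \<sigma> (x + 2 * of_int j - y)) * h y) \<in> borel_measurable m"
      using assms(2) by (intro borel_measurable_times meas) auto
    show "AE y in m. norm (of_real (gauss \<sigma> (x + 2 * of_int j - y)) * h y) \<le> norm (B j * norm (h y))"
      by (intro AE_I2 order_trans[OF bound]) auto
  qed
  show "((\<lambda>j. \<integral>y. of_real (gauss \<sigma> (x + 2 * of_int j - y)) * h y \<partial>m) has_sum
      (\<integral>y. of_real (theta \<sigma> (x - y)) * h y \<partial>m)) UNIV"
  proof (rule has_sum_integral[where B="\<lambda>j. B j * L1_norm m h"])
    show "(\<lambda>j. B j * L1_norm m h) summable_on UNIV"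
      unfolding B_def by (intro summable_on_cmult_left summable_gauss_bound assms(1))
    show "(\<integral>y. norm (of_real (gauss \<sigma> (x + 2 * of_int j - y)) * h y) \<partial>m) \<le> B j * L1_norm m h" for j
    proof -
      have "(\<integral>y. norm (of_real (gauss \<sigma> (x + 2 * of_int j - y)) * h y) \<partial>m) \<le> (\<integral>y. B j * norm (h y) \<partial>m)"
        using int assms(2) bound by (intro integral_mono) auto
      then show ?thesis by (simp add: L1_norm_def)
    qed
    fix y assume "y \<in> space m"
    have "((\<lambda>j. of_real (gauss \<sigma> (x - y + 2 * of_int j)) * h y) has_sum of_real (theta \<sigma> (x - y)) * h y) UNIV"
      by (intro has_sum_cmult_left has_sum_of_real theta_has_sum assms(1))
    moreover have "x - y + 2 * of_int j = x + 2 * of_int j - y" for j by simp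
    ultimately show "((\<lambda>j. of_real (gauss \<sigma> (x + 2 * of_int j - y)) * h y) has_sum
        of_real (theta \<sigma> (x - y)) * h y) UNIV" by (simp only:)
  qed (rule int)
qed

text \<open>
  Convolution with \<^const>\<open>theta\<close> multiplies Fourier coefficients; the series converges at every
  point because the multipliers are summable and the coefficients are bounded.
\<close>

lemma noise_has_sum:
  assumes "\<sigma> > 0" "integrable m h"
  shows "((\<lambda>l. of_real (gauss_multiplier \<sigma> l) * fourier_coeff h l * fourier_basis l x) has_sum noise \<sigma> h x) UNIV"
proof -
  define f where "f = (\<lambda>l y. of_real (gauss_multiplier \<sigma> l / 2) * fourier_basis l (x - y) * h y)"
  have f_eq: "f l y = of_real (gauss_multiplier \<sigma> l / 2) * fourier_basis l x * (h y * fourier_basis (- l) y)" for l y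
    using fourier_basis_add[of l x "- y"] by (simp add: f_def fourier_basis_neg_arg)
  have norm_f: "norm (f l y) = gauss_multiplier \<sigma> l * (norm (h y) / 2)" for l y
    using gauss_multiplier_pos[of \<sigma> l] by (simp add: f_def norm_mult)
  have "((\<lambda>l. \<integral>y. f l y \<partial>m) has_sum (\<integral>y. of_real (theta \<sigma> (x - y)) * h y \<partial>m)) UNIV"
  proof (rule has_sum_integral[where B="\<lambda>l. gauss_multiplier \<sigma> l * (L1_norm m h / 2)"])
    show "integrable m (f l)" for l
      unfolding f_eq[abs_def] by (intro integrable_mult_right integrable_mult_fourier_basis assms(2))
    show "(\<integral>y. norm (f l y) \<partial>m) \<le> gauss_multiplier \<sigma> l * (L1_norm m h / 2)" for l
      unfolding norm_f by (simp add: L1_norm_def)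
    show "(\<lambda>l. gauss_multiplier \<sigma> l * (L1_norm m h / 2)) summable_on UNIV"
      by (intro summable_on_cmult_left summable_gauss_multiplier assms(1))
    show "((\<lambda>l. f l y) has_sum of_real (theta \<sigma> (x - y)) * h y) UNIV" for y
      unfolding f_def by (intro has_sum_cmult_left theta_Poisson assms(1))
  qed
  moreover have "(\<integral>y. f l y \<partial>m)
      = of_real (gauss_multiplier \<sigma> l) * fourier_coeff h l * fourier_basis l x" for l
    unfolding f_eq fourier_coeff_def by simp
  ultimately show ?thesis by (simp add: noise_eq_integral_theta[OF assms])
qed

lemma annealed_PF_has_sum:
  assumes "\<sigma> > 0" "nonsingular_map T" "integrable m u"
  shows "((\<lambda>l. of_real (gauss_multiplier \<sigma> l) * transfer_coeff T u l * fourier_basis l x) has_sum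
    annealed_PF T \<sigma> u x) UNIV"
  using noise_has_sum[OF assms(1), of "perron_frobenius T u" x] perron_frobenius_is_density[OF assms(2,3)]
  by (simp add: annealed_PF_def fourier_coeff_perron_frobenius[OF assms(2,3)] is_pushforward_density_def)

section \<open>Absolutely convergent Fourier series\<close>

lemma fourier_series_continuous:
  fixes c :: "int \<Rightarrow> complex"
  assumes c: "(\<lambda>j. norm (c j)) summable_on UNIV"
    and f: "\<And>x. ((\<lambda>j. c j * fourier_basis j x) has_sum f x) UNIV"
  shows "continuous_on UNIV f" "norm (f x) \<le> (\<Sum>\<^sub>\<infinity>j. norm (c j))"
proof -
  have f_eq: "f = (\<lambda>x. \<Sum>\<^sub>\<infinity>j. c j * fourier_basis j x)"
    by (rule ext) (rule infsumI[OF f, symmetric])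
  show "continuous_on UNIV f"
    unfolding f_eq
    by (rule continuous_on_infsum[OF _ _ c])
       (auto intro!: continuous_intros continuous_fourier_basis simp: norm_mult)
  show "norm (f x) \<le> (\<Sum>\<^sub>\<infinity>j. norm (c j))"
    by (rule norm_infsum_le[OF f[of x] has_sum_infsum[OF c]]) (simp add: norm_mult)
qed

text \<open>
  The last claim is Parseval's identity: expand the second factor of \<open>f * cnj f\<close> and integrate
  term by term.
\<close>

lemma fourier_series_L2:
  fixes c :: "int \<Rightarrow> complex"
  assumes c: "(\<lambda>j. norm (c j)) summable_on UNIV"
    and f: "\<And>x. ((\<lambda>j. c j * fourier_basis j x) has_sum f x) UNIV"
  shows "f \<in> L2" "L2_norm m f \<le> sqrt 2 * (\<Sum>\<^sub>\<infinity>j. norm (c j))"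
    and "fourier_coeff f l = c l"
    and "((\<lambda>j. 2 * (norm (c j))\<^sup>2) has_sum (L2_norm m f)\<^sup>2) UNIV"
proof -
  have meas: "f \<in> borel_measurable m"
    by (rule continuous_imp_measurable_m[OF fourier_series_continuous(1)[OF c f]])
  have bound: "AE x in m. norm (f x) \<le> (\<Sum>\<^sub>\<infinity>j. norm (c j))"
    by (rule AE_I2[OF fourier_series_continuous(2)[OF c f]])
  show L2: "f \<in> L2" and "L2_norm m f \<le> sqrt 2 * (\<Sum>\<^sub>\<infinity>j. norm (c j))"
    by (rule bounded_imp_L2[OF meas bound])+
  have coeff: "(\<integral>x. f x * fourier_basis (- j) x \<partial>m) = 2 * c j" for j
    by (rule fourier_coeff_of_series[OF c f])
  then show "fourier_coeff f l = c l" by (simp add: fourier_coeff_def)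
  have int: "integrable m f" using L2 by (rule L2_imp_integrable)
  define F where "F = (\<lambda>j x. cnj (c j) * (f x * fourier_basis (- j) x))"
  have norm_F: "norm (F j x) = norm (c j) * norm (f x)" for j x by (simp add: F_def norm_mult)
  have "((\<lambda>j. \<integral>x. F j x \<partial>m) has_sum (\<integral>x. f x * cnj (f x) \<partial>m)) UNIV"
  proof (rule has_sum_integral[where B="\<lambda>j. norm (c j) * L1_norm m f"])
    show "integrable m (F j)" for j
      unfolding F_def by (intro integrable_mult_right integrable_mult_fourier_basis int)
    show "(\<integral>x. norm (F j x) \<partial>m) \<le> norm (c j) * L1_norm m f" for j
      unfolding norm_F by (simp add: L1_norm_def)
    show "(\<lambda>j. norm (c j) * L1_norm m f) summable_on UNIV"
      using c by (rule summable_on_cmult_left)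
    show "((\<lambda>j. F j x) has_sum f x * cnj (f x)) UNIV" for x
    proof -
      have "((\<lambda>j. cnj (c j * fourier_basis j x)) has_sum cnj (f x)) UNIV"
        using f[of x] by (subst has_sum_cnj_iff)
      then have "((\<lambda>j. f x * cnj (c j * fourier_basis j x)) has_sum f x * cnj (f x)) UNIV"
        by (rule has_sum_cmult_right)
      then show ?thesis by (simp add: F_def fourier_basis_uminus mult_ac)
    qed
  qed
  moreover have "(\<integral>x. F j x \<partial>m) = of_real (2 * (norm (c j))\<^sup>2)" for j
  proof -
    have "(\<integral>x. F j x \<partial>m) = cnj (c j) * (2 * c j)"
      unfolding F_def integral_mult_right_zero coeff ..
    then show ?thesis by (simp add: complex_norm_square mult_ac del: of_real_power)
  qed
  moreover have "(\<integral>x. f x * cnj (f x) \<partial>m) = of_real ((L2_norm m f)\<^sup>2)"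
    unfolding L2_norm_power2
    by (subst integral_complex_of_real[symmetric]) (simp add: complex_norm_square del: of_real_power)
  ultimately show "((\<lambda>j. 2 * (norm (c j))\<^sup>2) has_sum (L2_norm m f)\<^sup>2) UNIV"
    by (simp only: has_sum_of_real_iff)
qed

definition trig_sum :: "nat \<Rightarrow> (int \<Rightarrow> complex) \<Rightarrow> real \<Rightarrow> complex" where
  "trig_sum k c x = (\<Sum>j\<in>{j. \<bar>j\<bar> \<le> int k}. c j * fourier_basis j x)"

lemma finite_abs_le [simp]: "finite {j::int. \<bar>j\<bar> \<le> int k}"
  by (rule finite_subset[of _ "{- int k..int k}"]) auto

text \<open>
  Padding the coefficients with zeros turns a trigonometric polynomial into a Fourier series, to
  which the preceding results apply.
\<close>

lemma trig_sum_series: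
  fixes c :: "int \<Rightarrow> complex" and k :: nat
  defines "c' \<equiv> \<lambda>j. if \<bar>j\<bar> \<le> int k then c j else 0"
  shows "(\<lambda>j. norm (c' j)) summable_on UNIV"
    and "((\<lambda>j. c' j * fourier_basis j x) has_sum trig_sum k c x) UNIV"
proof -
  have "((\<lambda>j. norm (c' j)) has_sum (\<Sum>j\<in>{j. \<bar>j\<bar> \<le> int k}. norm (c' j))) UNIV"
    by (rule has_sum_finite_neutralI[of "{j. \<bar>j\<bar> \<le> int k}"]) (auto simp: c'_def)
  then show "(\<lambda>j. norm (c' j)) summable_on UNIV" by (rule has_sum_imp_summable)
  show "((\<lambda>j. c' j * fourier_basis j x) has_sum trig_sum k c x) UNIV"
    unfolding trig_sum_def by (rule has_sum_finite_neutralI[of "{j. \<bar>j\<bar> \<le> int k}"]) (auto simp: c'_def)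
qed

lemma trig_sum_L2: "trig_sum k c \<in> L2"
  by (rule fourier_series_L2(1)[OF trig_sum_series])

lemma integrable_trig_sum: "integrable m (trig_sum k c)"
  by (rule L2_imp_integrable[OF trig_sum_L2])

lemma fourier_coeff_trig_sum:
  "fourier_coeff (trig_sum k c) l = (if \<bar>l\<bar> \<le> int k then c l else 0)"
  by (rule fourier_series_L2(3)[OF trig_sum_series])

lemma integral_eq_fourier_coeff_0: "(\<integral>x. f x \<partial>m) = 2 * fourier_coeff f 0"
  by (simp add: fourier_coeff_def)

lemma L2_norm_trig_sum:
  "(L2_norm m (trig_sum k c))\<^sup>2 = 2 * (\<Sum>j\<in>{j. \<bar>j\<bar> \<le> int k}. (norm (c j))\<^sup>2)"
proof -
  define c' where "c' = (\<lambda>j. if \<bar>j\<bar> \<le> int k then c j else 0)"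
  have "((\<lambda>j. 2 * (norm (c' j))\<^sup>2) has_sum (L2_norm m (trig_sum k c))\<^sup>2) UNIV"
    unfolding c'_def by (rule fourier_series_L2(4)[OF trig_sum_series])
  moreover have "((\<lambda>j. 2 * (norm (c' j))\<^sup>2) has_sum (\<Sum>j\<in>{j. \<bar>j\<bar> \<le> int k}. 2 * (norm (c j))\<^sup>2)) UNIV"
    by (rule has_sum_finite_neutralI[of "{j. \<bar>j\<bar> \<le> int k}"]) (auto simp: c'_def)
  ultimately show ?thesis by (metis has_sum_unique sum_distrib_left)
qed

lemma norm_trig_sum_le:
  assumes "\<And>j. norm (c j) \<le> b"
  shows "norm (trig_sum k c x) \<le> real (card {j. \<bar>j\<bar> \<le> int k}) * b"
  unfolding trig_sum_def
  by (rule order_trans[OF norm_sum sum_bounded_above]) (simp add: norm_mult assms)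

lemma trig_sum_diff: "trig_sum k (\<lambda>j. c j - d j) x = trig_sum k c x - trig_sum k d x"
  by (simp add: trig_sum_def left_diff_distrib sum_subtractf)

lemma fourier_proj_eq_trig_sum: "fourier_proj k f = trig_sum k (fourier_coeff f)"
  by (simp add: fun_eq_iff fourier_proj_def trig_sum_def)

lemma fourier_coeff_diff:
  assumes "integrable m u" "integrable m v"
  shows "fourier_coeff (\<lambda>x. u x - v x) l = fourier_coeff u l - fourier_coeff v l"
  unfolding fourier_coeff_def
  using Bochner_Integration.integral_diff[OF integrable_mult_fourier_basis[OF assms(1), of "- l"]
      integrable_mult_fourier_basis[OF assms(2), of "- l"]]
  by (simp add: left_diff_distrib right_diff_distrib)

lemma norm_fourier_coeff_le: "norm (fourier_coeff u l) \<le> L1_norm m u / 2"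
proof -
  have "norm (\<integral>x. u x * fourier_basis (- l) x \<partial>m) \<le> (\<integral>x. norm (u x * fourier_basis (- l) x) \<partial>m)"
    by (rule integral_norm_bound)
  then show ?thesis by (simp add: fourier_coeff_def L1_norm_def norm_mult)
qed

lemma fourier_coeff_cong_AE:
  assumes "AE x in m. f x = g x" "f \<in> borel_measurable m" "g \<in> borel_measurable m"
  shows "fourier_coeff f l = fourier_coeff g l"
proof -
  have "(\<integral>x. f x * fourier_basis (- l) x \<partial>m) = (\<integral>x. g x * fourier_basis (- l) x \<partial>m)"
    using assms by (intro integral_cong_AE) auto
  then show ?thesis by (simp add: fourier_coeff_def)
qed

lemma norm_coeff_annealed_le:
  "norm (of_real (gauss_multiplier \<sigma> l) * transfer_coeff T u l) \<le> gauss_multiplier \<sigma> l * (L1_norm m u / 2)"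
  unfolding norm_mult using norm_transfer_coeff_le[of T u l] gauss_multiplier_pos[of \<sigma> l]
  by (simp add: mult_left_mono)

lemma gauss_multiplier_le_1: "gauss_multiplier \<sigma> l \<le> 1"
  by (simp add: gauss_multiplier_def)

lemma annealed_PF_series:
  fixes T \<sigma> u
  defines "c \<equiv> \<lambda>l. of_real (gauss_multiplier \<sigma> l) * transfer_coeff T u l"
  assumes "\<sigma> > 0" "nonsingular_map T" "integrable m u"
  shows "(\<lambda>l. norm (c l)) summable_on UNIV"
    and "((\<lambda>l. c l * fourier_basis l x) has_sum annealed_PF T \<sigma> u x) UNIV"
proof -
  show "(\<lambda>l. norm (c l)) summable_on UNIV"
  proof (rule summable_on_comparison_test)
    show "(\<lambda>l. gauss_multiplier \<sigma> l * (L1_norm m u / 2)) summable_on UNIV"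
      by (intro summable_on_cmult_left summable_gauss_multiplier assms)
    show "norm (c l) \<le> gauss_multiplier \<sigma> l * (L1_norm m u / 2)" for l
      unfolding c_def by (rule norm_coeff_annealed_le)
  qed simp
  show "((\<lambda>l. c l * fourier_basis l x) has_sum annealed_PF T \<sigma> u x) UNIV"
    unfolding c_def by (rule annealed_PF_has_sum[OF assms(2-4)])
qed

section \<open>The Galerkin operator on mean-zero functions\<close>

lemma galerkin_PF_eq_trig_sum:
  assumes "\<sigma> > 0" "nonsingular_map T"
  shows "galerkin_PF T \<sigma> k u = trig_sum k (\<lambda>l. of_real (gauss_multiplier \<sigma> l) * transfer_coeff T (fourier_proj k u) l)"
proof -
  have int: "integrable m (fourier_proj k u)"
    unfolding fourier_proj_eq_trig_sum by (rule integrable_trig_sum)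
  show ?thesis
    unfolding galerkin_PF_def fourier_proj_eq_trig_sum[of k "annealed_PF T \<sigma> (fourier_proj k u)"]
    by (intro arg_cong[where f="trig_sum k"] ext fourier_series_L2(3)[OF annealed_PF_series[OF assms int]])
qed

lemma galerkin_PF_diff:
  assumes "\<sigma> > 0" "nonsingular_map T" "integrable m u" "integrable m v"
  shows "galerkin_PF T \<sigma> k (\<lambda>x. u x - v x) = (\<lambda>x. galerkin_PF T \<sigma> k u x - galerkin_PF T \<sigma> k v x)"
proof -
  have "fourier_proj k (\<lambda>x. u x - v x) = (\<lambda>x. fourier_proj k u x - fourier_proj k v x)"
    unfolding fourier_proj_eq_trig_sum fourier_coeff_diff[OF assms(3,4)]
    by (rule ext) (rule trig_sum_diff)
  then have "transfer_coeff T (fourier_proj k (\<lambda>x. u x - v x)) l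
      = transfer_coeff T (fourier_proj k u) l - transfer_coeff T (fourier_proj k v) l" for l
    by (simp add: transfer_coeff_diff[OF assms(2)] fourier_proj_eq_trig_sum integrable_trig_sum)
  then show ?thesis
    by (simp add: galerkin_PF_eq_trig_sum[OF assms(1,2)] right_diff_distrib trig_sum_diff fun_eq_iff)
qed

lemma galerkin_PF_L2:
  assumes "\<sigma> > 0" "nonsingular_map T" shows "galerkin_PF T \<sigma> k u \<in> L2"
  unfolding galerkin_PF_eq_trig_sum[OF assms] by (rule trig_sum_L2)

text \<open>
  Mass is the coefficient at frequency 0. The multiplier there is 1, and \<open>e\<^sub>0 \<circ> T = 1\<close>.
\<close>

lemma integral_galerkin_PF:
  assumes "\<sigma> > 0" "nonsingular_map T"
  shows "(\<integral>x. galerkin_PF T \<sigma> k u x \<partial>m) = (\<integral>x. u x \<partial>m)"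
proof -
  have "(\<integral>x. galerkin_PF T \<sigma> k u x \<partial>m) = (\<integral>x. fourier_proj k u x \<partial>m)"
    unfolding integral_eq_fourier_coeff_0[of "galerkin_PF T \<sigma> k u"]
    by (simp add: galerkin_PF_eq_trig_sum[OF assms] fourier_coeff_trig_sum transfer_coeff_0)
  also have "\<dots> = (\<integral>x. u x \<partial>m)"
    unfolding integral_eq_fourier_coeff_0 fourier_proj_eq_trig_sum fourier_coeff_trig_sum by simp
  finally show ?thesis .
qed

lemma L1_norm_le_bound:
  fixes f :: "real \<Rightarrow> complex"
  assumes "\<And>x. norm (f x) \<le> b" "integrable m f" shows "L1_norm m f \<le> 2 * b"
proof -
  have "L1_norm m f \<le> (\<integral>x. b \<partial>m)"
    unfolding L1_norm_def using assms by (intro integral_mono integrable_norm) auto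
  then show ?thesis by (simp only: integral_const_m)
qed

text \<open>
  The constant is crude. It only serves to show that the suprema defining the operator norms are
  taken over bounded sets.
\<close>

lemma galerkin_PF_bounded:
  assumes "\<sigma> > 0" "nonsingular_map T" "u \<in> L2"
  shows "L2_norm m (galerkin_PF T \<sigma> k u) \<le> (real (card {j. \<bar>j\<bar> \<le> int k}))\<^sup>2 * L2_norm m u"
proof -
  define N where "N = real (card {j. \<bar>j\<bar> \<le> int k})"
  define L where "L = L1_norm m u"
  have "norm (fourier_proj k u x) \<le> N * (L / 2)" for x
    unfolding fourier_proj_eq_trig_sum N_def L_def by (intro norm_trig_sum_le norm_fourier_coeff_le)
  then have "L1_norm m (fourier_proj k u) \<le> 2 * (N * (L / 2))"
    by (rule L1_norm_le_bound) (simp add: fourier_proj_eq_trig_sum integrable_trig_sum)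
  then have proj: "L1_norm m (fourier_proj k u) / 2 \<le> N * L / 2" by simp
  have coeff: "norm (of_real (gauss_multiplier \<sigma> l) * transfer_coeff T (fourier_proj k u) l) \<le> N * L / 2" for l
  proof -
    have "norm (of_real (gauss_multiplier \<sigma> l) * transfer_coeff T (fourier_proj k u) l)
        \<le> 1 * norm (transfer_coeff T (fourier_proj k u) l)"
      unfolding norm_mult using gauss_multiplier_le_1[of \<sigma> l] gauss_multiplier_pos[of \<sigma> l]
      by (intro mult_right_mono) auto
    then show ?thesis using norm_transfer_coeff_le[of T "fourier_proj k u" l] proj by linarith
  qed
  have bound: "norm (galerkin_PF T \<sigma> k u x) \<le> N * (N * L / 2)" for x
    unfolding galerkin_PF_eq_trig_sum[OF assms(1,2)] N_def
    by (rule norm_trig_sum_le[OF coeff[unfolded N_def]])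
  have meas: "galerkin_PF T \<sigma> k u \<in> borel_measurable m"
    using galerkin_PF_L2[OF assms(1,2)] by (simp add: L2_def)
  have "L2_norm m (galerkin_PF T \<sigma> k u) \<le> sqrt 2 * (N * (N * L / 2))"
    by (rule bounded_imp_L2(2)[OF meas AE_I2[OF bound]])
  also have "\<dots> = N\<^sup>2 * (sqrt 2 / 2 * L)" by (simp add: power2_eq_square)
  also have "\<dots> \<le> N\<^sup>2 * L2_norm m u"
  proof (rule mult_left_mono)
    have "sqrt 2 / 2 * L \<le> sqrt 2 / 2 * (sqrt 2 * L2_norm m u)"
      unfolding L_def by (intro mult_left_mono L1_norm_le_L2_norm assms(3)) simp
    also have "\<dots> = L2_norm m u" by simp
    finally show "sqrt 2 / 2 * L \<le> L2_norm m u" .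
  qed simp
  finally show ?thesis by (simp add: N_def)
qed

lemma U0_diff: "u \<in> U0 \<Longrightarrow> v \<in> U0 \<Longrightarrow> (\<lambda>x. u x - v x) \<in> U0"
  by (simp add: U0_def L2_sum_diff_product(2) Bochner_Integration.integral_diff L2_imp_integrable)

lemma galerkin_PF_U0:
  assumes "\<sigma> > 0" "nonsingular_map T" "u \<in> U0" shows "(galerkin_PF T \<sigma> k ^^ i) u \<in> U0"
proof (induction i)
  case (Suc i)
  then show ?case
    using galerkin_PF_L2[OF assms(1,2)] integral_galerkin_PF[OF assms(1,2)] by (simp add: U0_def)
qed (simp add: assms)

lemma galerkin_PF_iterate_bounded:
  assumes "\<sigma> > 0" "nonsingular_map T" "u \<in> U0"
  shows "L2_norm m ((galerkin_PF T \<sigma> k ^^ i) u)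
    \<le> ((real (card {j. \<bar>j\<bar> \<le> int k}))\<^sup>2) ^ i * L2_norm m u"
proof (induction i)
  case (Suc i)
  have "(galerkin_PF T \<sigma> k ^^ i) u \<in> L2" using galerkin_PF_U0[OF assms] by (simp add: U0_def)
  from galerkin_PF_bounded[OF assms(1,2) this, of k]
  have "L2_norm m ((galerkin_PF T \<sigma> k ^^ Suc i) u)
      \<le> (real (card {j. \<bar>j\<bar> \<le> int k}))\<^sup>2 * L2_norm m ((galerkin_PF T \<sigma> k ^^ i) u)" by simp
  also have "\<dots> \<le> (real (card {j. \<bar>j\<bar> \<le> int k}))\<^sup>2 *
      (((real (card {j. \<bar>j\<bar> \<le> int k}))\<^sup>2) ^ i * L2_norm m u)"
    by (intro mult_left_mono Suc.IH) simp
  finally show ?case by (simp add: mult.assoc)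
qed simp

text \<open>
  When \<open>u\<close> has norm 0 its quotient in the supremum is \<open>x / 0 = 0\<close> and carries no information;
  there the second claim comes from boundedness.
\<close>

lemma galerkin_PF_iterate_opnorm:
  assumes "\<sigma> > 0" "nonsingular_map T"
  shows "0 \<le> L2_opnorm_on U0 (galerkin_PF T \<sigma> k ^^ i)"
    and "u \<in> U0 \<Longrightarrow> L2_norm m ((galerkin_PF T \<sigma> k ^^ i) u)
      \<le> L2_opnorm_on U0 (galerkin_PF T \<sigma> k ^^ i) * L2_norm m u"
proof -
  define K where "K = ((real (card {j. \<bar>j\<bar> \<le> int k}))\<^sup>2) ^ i"
  have K: "L2_norm m ((galerkin_PF T \<sigma> k ^^ i) u) \<le> K * L2_norm m u" if "u \<in> U0" for u
    unfolding K_def by (rule galerkin_PF_iterate_bounded[OF assms that])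
  have "bdd_above ((\<lambda>u. L2_norm m ((galerkin_PF T \<sigma> k ^^ i) u) / L2_norm m u) ` U0)"
  proof (rule bdd_aboveI2)
    fix u assume "u \<in> U0"
    then show "L2_norm m ((galerkin_PF T \<sigma> k ^^ i) u) / L2_norm m u \<le> K"
      using K[of u] L2_norm_nonneg[of m u] by (cases "L2_norm m u = 0") (auto simp: K_def divide_le_eq)
  qed
  then have le: "L2_norm m ((galerkin_PF T \<sigma> k ^^ i) u) / L2_norm m u
      \<le> L2_opnorm_on U0 (galerkin_PF T \<sigma> k ^^ i)" if "u \<in> U0" for u
    unfolding L2_opnorm_on_def using that by (intro cSUP_upper)
  have "(\<lambda>x. 0) \<in> U0" by (simp add: U0_def L2_def)
  from le[OF this] show "0 \<le> L2_opnorm_on U0 (galerkin_PF T \<sigma> k ^^ i)"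
    by (simp add: L2_norm_def)
  show "L2_norm m ((galerkin_PF T \<sigma> k ^^ i) u)
      \<le> L2_opnorm_on U0 (galerkin_PF T \<sigma> k ^^ i) * L2_norm m u" if "u \<in> U0"
    using le[OF that] K[OF that] L2_norm_nonneg[of m u]
    by (cases "L2_norm m u = 0") (auto simp: divide_le_eq)
qed

lemma galerkin_PF_iterate_diff:
  assumes "\<sigma> > 0" "nonsingular_map T" "u \<in> U0" "v \<in> U0"
  shows "(galerkin_PF T \<sigma> k ^^ i) (\<lambda>x. u x - v x)
    = (\<lambda>x. (galerkin_PF T \<sigma> k ^^ i) u x - (galerkin_PF T \<sigma> k ^^ i) v x)"
proof (induction i)
  case (Suc i)
  have "integrable m ((galerkin_PF T \<sigma> k ^^ i) w)" if "w \<in> U0" for w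
    using galerkin_PF_U0[OF assms(1,2) that] by (simp add: U0_def L2_imp_integrable)
  then show ?case using Suc.IH assms by (simp add: galerkin_PF_diff)
qed simp

text \<open>
  With \<open>A\<close> for the Galerkin operator, \<open>A\<^sup>n u - u\<close> is the sum of \<open>A\<^sup>i r\<close> over \<open>i < n\<close>, and the
  norm of \<open>A\<^sup>n u\<close> is at most \<open>C n\<close> times that of \<open>u\<close>.
\<close>

lemma galerkin_PF_norm_le_defect:
  fixes k :: nat
  assumes "\<sigma> > 0" "nonsingular_map T" "u \<in> U0"
  defines "C \<equiv> \<lambda>i. L2_opnorm_on U0 (galerkin_PF T \<sigma> k ^^ i)"
    and "r \<equiv> \<lambda>x. galerkin_PF T \<sigma> k u x - u x"
  shows "(1 - C n) * L2_norm m u \<le> (\<Sum>i<n. C i * L2_norm m r)"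
proof -
  define A where "A = galerkin_PF T \<sigma> k"
  have U0: "(A ^^ i) w \<in> U0" if "w \<in> U0" for i w
    unfolding A_def by (rule galerkin_PF_U0[OF assms(1,2) that])
  have L2: "(A ^^ i) w \<in> L2" if "w \<in> U0" for i w using U0[OF that] by (simp add: U0_def)
  have Au: "A u \<in> U0" using U0[OF assms(3), of 1] by simp
  have r: "r \<in> U0" unfolding r_def using U0_diff[OF Au assms(3)] by (simp add: A_def)
  have "L2_norm m (\<lambda>x. (A ^^ n) u x - u x) \<le> (\<Sum>i<n. C i * L2_norm m r)"
  proof (induction n)
    case 0
    then show ?case by (simp add: L2_norm_def)
  next
    case (Suc n)
    have "(A ^^ n) r = (\<lambda>x. (A ^^ Suc n) u x - (A ^^ n) u x)"
      unfolding r_def funpow_Suc_right o_apply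
      using galerkin_PF_iterate_diff[OF assms(1,2) Au assms(3), where k=k and i=n] by (simp add: A_def)
    then have "L2_norm m (\<lambda>x. (A ^^ Suc n) u x - u x)
        = L2_norm m (\<lambda>x. (A ^^ n) r x + ((A ^^ n) u x - u x))" by simp
    also have "\<dots> \<le> L2_norm m ((A ^^ n) r) + L2_norm m (\<lambda>x. (A ^^ n) u x - u x)"
      using L2[OF r, of n] L2[OF assms(3), of n] L2[OF assms(3), of 0]
      by (intro L2_norm_triangle L2_sum_diff_product(2)) simp_all
    also have "\<dots> \<le> C n * L2_norm m r + (\<Sum>i<n. C i * L2_norm m r)"
      using galerkin_PF_iterate_opnorm(2)[OF assms(1,2) r, where k=k and i=n] Suc.IH
      unfolding C_def A_def by (rule add_mono)
    finally show ?case by simp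
  qed
  moreover have "L2_norm m u \<le> L2_norm m ((A ^^ n) u) + L2_norm m (\<lambda>x. (A ^^ n) u x - u x)"
  proof -
    have "L2_norm m (\<lambda>x. (A ^^ n) u x - ((A ^^ n) u x - u x))
        \<le> L2_norm m ((A ^^ n) u) + L2_norm m (\<lambda>x. (A ^^ n) u x - u x)"
      using L2[OF assms(3), of n] L2[OF assms(3), of 0]
      by (intro L2_norm_triangle_diff L2_sum_diff_product(2)) simp_all
    then show ?thesis by simp
  qed
  moreover have "L2_norm m ((A ^^ n) u) \<le> C n * L2_norm m u"
    unfolding A_def C_def by (rule galerkin_PF_iterate_opnorm(2)[OF assms(1,2,3)])
  ultimately show ?thesis by (simp add: algebra_simps)
qed

section \<open>The residual of the fixed point\<close>

lemma L2_norm_gauss: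
  assumes "\<sigma> > 0" shows "(L2_norm lborel (gauss \<sigma>))\<^sup>2 = 1 / (2 * \<sigma> * sqrt pi)"
proof -
  have sq: "(norm (gauss \<sigma> x))\<^sup>2 = 1 / (2 * \<sigma> * sqrt pi) * normal_density 0 (\<sigma> / sqrt 2) x" for x
  proof -
    have "(exp (- (x\<^sup>2 / (2 * \<sigma>\<^sup>2))))\<^sup>2 = exp (- (x\<^sup>2 / \<sigma>\<^sup>2))"
      by (simp add: exp_double[symmetric])
    moreover have "sqrt (2 * pi * (\<sigma> / sqrt 2)\<^sup>2) = \<sigma> * sqrt pi"
      using assms by (simp add: power_divide real_sqrt_mult)
    moreover have "2 * (\<sigma> / sqrt 2)\<^sup>2 = \<sigma>\<^sup>2" by (simp add: power_divide)
    ultimately show ?thesis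
      using assms by (simp add: normal_density_def power_mult_distrib power_divide power2_eq_square)
  qed
  have "(\<integral>x. normal_density 0 (\<sigma> / sqrt 2) x \<partial>lborel) = 1"
    by (rule integral_normal_density) (use assms in simp)
  then show ?thesis unfolding L2_norm_power2 sq by simp
qed

lemma coth_ge_1:
  assumes "x > 0" shows "coth x \<ge> 1"
proof -
  have "sinh x \<le> cosh x" using cosh_minus_sinh[of x] exp_gt_zero[of "- x"] by linarith
  then show ?thesis using assms by (simp add: coth_def)
qed

lemma gauss_multiplier_power2:
  "(gauss_multiplier \<sigma> l)\<^sup>2 = exp (- (\<sigma>\<^sup>2 * pi\<^sup>2 * (of_int l)\<^sup>2))"
  by (simp add: gauss_multiplier_def exp_double[symmetric])

lemma sqrt_pi_div: "\<sigma> > 0 \<Longrightarrow> sqrt (pi / (\<sigma>\<^sup>2 * pi\<^sup>2)) = 1 / (\<sigma> * sqrt pi)"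
  by (simp add: real_sqrt_divide real_sqrt_mult power2_eq_square)

lemma Gamma1_eq: "Gamma1 \<sigma> k = (\<Sum>\<^sub>\<infinity>j\<in>{j. \<bar>j\<bar> > int k}. gauss_multiplier \<sigma> j)"
  by (simp add: Gamma1_def gauss_multiplier_def)

lemma Gamma1_nonneg: "Gamma1 \<sigma> k \<ge> 0"
  unfolding Gamma1_eq by (intro infsum_nonneg less_imp_le gauss_multiplier_pos)

lemma Gamma0_nonneg:
  assumes "\<sigma> > 0" shows "Gamma0 \<sigma> k \<ge> 0"
  using coth_ge_1[of "1 / (2 * \<sigma>\<^sup>2)"] assms by (simp add: Gamma0_def)

lemma tail_power2_le_Gamma0:
  assumes "\<sigma> > 0" "finite F" "F \<subseteq> {j. \<bar>j\<bar> > int k}"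
  shows "(\<Sum>j\<in>F. (gauss_multiplier \<sigma> j)\<^sup>2) \<le> (Gamma0 \<sigma> k)\<^sup>2"
proof -
  have "(\<Sum>j\<in>F. (gauss_multiplier \<sigma> j)\<^sup>2) \<le> exp (- (\<sigma>\<^sup>2 * pi\<^sup>2 * (real k)\<^sup>2)) * (1 / (\<sigma> * sqrt pi))"
    unfolding gauss_multiplier_power2
    using sum_gaussian_tail_le[of "\<sigma>\<^sup>2 * pi\<^sup>2", OF _ assms(2,3)] assms(1) by (simp add: sqrt_pi_div)
  also have "\<dots> \<le> exp (- (\<sigma>\<^sup>2 * pi\<^sup>2 * (real k)\<^sup>2)) * (1 / (\<sigma> * sqrt pi) * coth (1 / (2 * \<sigma>\<^sup>2)))"
    using coth_ge_1[of "1 / (2 * \<sigma>\<^sup>2)"] assms(1) by (intro mult_left_mono) (auto simp: divide_right_mono)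
  also have "\<dots> = (Gamma0 \<sigma> k)\<^sup>2"
  proof -
    have "0 \<le> 1 / (\<sigma> * sqrt pi) * coth (1 / (2 * \<sigma>\<^sup>2))"
      using coth_ge_1[of "1 / (2 * \<sigma>\<^sup>2)"] assms(1) by simp
    then have "(Gamma0 \<sigma> k)\<^sup>2 = 1 / (\<sigma> * sqrt pi) * coth (1 / (2 * \<sigma>\<^sup>2)) *
        (exp (- (\<sigma>\<^sup>2 * pi\<^sup>2 * (real k)\<^sup>2 / 2)))\<^sup>2"
      unfolding Gamma0_def power_mult_distrib by (simp only: real_sqrt_pow2)
    then show ?thesis by (simp add: exp_double[symmetric])
  qed
  finally show ?thesis .
qed

text \<open>
  Truncating the series of \<open>P\<^sub>\<sigma> u\<close> removes the low frequencies exactly, so \<open>v\<close> is the series over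
  \<open>\<bar>l\<bar> > k\<close>, with coefficients at most \<open>exp (- \<sigma>\<^sup>2 \<pi>\<^sup>2 l\<^sup>2 / 2)\<close> times half the \<open>L\<^sup>1\<close>-norm of
  \<open>u\<close>. Summing these gives the bounds by \<^const>\<open>Gamma1\<close>, summing their squares the one by
  \<^const>\<open>Gamma0\<close>.
\<close>

lemma annealed_PF_tail:
  fixes k :: nat
  assumes "\<sigma> > 0" "nonsingular_map T" "integrable m u"
  defines "F \<equiv> annealed_PF T \<sigma> u"
  defines "v \<equiv> \<lambda>x. F x - fourier_proj k F x"
  shows "v \<in> L2" and "fourier_coeff v 0 = 0"
    and "norm (v x) \<le> Gamma1 \<sigma> k * (L1_norm m u / 2)"
    and "L2_norm m v \<le> Gamma0 \<sigma> k * L1_norm m u"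
    and "L2_norm m v \<le> Gamma1 \<sigma> k * L1_norm m u"
proof -
  define c where "c = (\<lambda>l. of_real (gauss_multiplier \<sigma> l) * transfer_coeff T u l)"
  define t where "t = (\<lambda>l. if \<bar>l\<bar> \<le> int k then 0 else c l)"
  define L where "L = L1_norm m u"
  have L: "L \<ge> 0" unfolding L_def L1_norm_def by (simp add: integral_nonneg_AE)
  note series = annealed_PF_series[OF assms(1-3)]
  have c_sum: "(\<lambda>l. norm (c l)) summable_on UNIV"
    and F_sum: "\<And>x. ((\<lambda>l. c l * fourier_basis l x) has_sum F x) UNIV"
    unfolding c_def F_def by (rule series)+
  have F_coeff: "fourier_coeff F = c"
    by (rule ext) (rule fourier_series_L2(3)[OF c_sum F_sum])
  have norm_t: "norm (t l) \<le> (if \<bar>l\<bar> > int k then gauss_multiplier \<sigma> l * (L / 2) else 0)" for l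
    using norm_coeff_annealed_le[of \<sigma> l T u] by (simp add: t_def c_def L_def)
  have t_sum: "(\<lambda>l. norm (t l)) summable_on UNIV"
    by (rule summable_on_comparison_test[OF c_sum]) (auto simp: t_def)
  have v_sum: "((\<lambda>l. t l * fourier_basis l x) has_sum v x) UNIV" for x
  proof -
    have "((\<lambda>l. c l * fourier_basis l x - (if \<bar>l\<bar> \<le> int k then c l else 0) * fourier_basis l x)
        has_sum F x - trig_sum k c x) UNIV"
      unfolding diff_conv_add_uminus
      by (intro has_sum_add F_sum has_sum_uminusI trig_sum_series(2))
    moreover have "c l * fourier_basis l x - (if \<bar>l\<bar> \<le> int k then c l else 0) * fourier_basis l x
        = t l * fourier_basis l x" for l
      by (simp add: t_def)
    ultimately show ?thesis
      by (simp add: v_def fourier_proj_eq_trig_sum F_coeff)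
  qed
  show "v \<in> L2" by (rule fourier_series_L2(1)[OF t_sum v_sum])
  show "fourier_coeff v 0 = 0"
    using fourier_series_L2(3)[OF t_sum v_sum, of 0] by (simp add: t_def)
  have norm_t_sum: "(\<Sum>\<^sub>\<infinity>l. norm (t l)) \<le> Gamma1 \<sigma> k * (L / 2)"
  proof -
    have "(\<Sum>\<^sub>\<infinity>l. norm (t l)) = (\<Sum>\<^sub>\<infinity>l\<in>{l. \<bar>l\<bar> > int k}. norm (t l))"
      by (rule infsum_cong_neutral) (auto simp: t_def)
    also have "\<dots> \<le> (\<Sum>\<^sub>\<infinity>l\<in>{l. \<bar>l\<bar> > int k}. gauss_multiplier \<sigma> l * (L / 2))"
    proof (rule infsum_mono)
      show "(\<lambda>l. norm (t l)) summable_on {l. \<bar>l\<bar> > int k}"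
        by (rule summable_on_subset_banach[OF t_sum]) simp
      show "(\<lambda>l. gauss_multiplier \<sigma> l * (L / 2)) summable_on {l. \<bar>l\<bar> > int k}"
        by (intro summable_on_cmult_left summable_gauss_multiplier assms)
      show "norm (t l) \<le> gauss_multiplier \<sigma> l * (L / 2)" if "l \<in> {l. \<bar>l\<bar> > int k}" for l
        using norm_t[of l] that by simp
    qed
    also have "\<dots> = Gamma1 \<sigma> k * (L / 2)"
      unfolding Gamma1_eq
      by (intro infsum_cmult_left summable_gauss_multiplier assms)
    finally show ?thesis .
  qed
  show "norm (v x) \<le> Gamma1 \<sigma> k * (L1_norm m u / 2)"
    using fourier_series_continuous(2)[OF t_sum v_sum, of x] norm_t_sum unfolding L_def by linarith
  have "L2_norm m v \<le> sqrt 2 * (\<Sum>\<^sub>\<infinity>l. norm (t l))" by (rule fourier_series_L2(2)[OF t_sum v_sum])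
  also have "\<dots> \<le> sqrt 2 * (Gamma1 \<sigma> k * (L / 2))" using norm_t_sum by (intro mult_left_mono) auto
  also have "\<dots> \<le> 2 * (Gamma1 \<sigma> k * (L / 2))"
    using Gamma1_nonneg[of \<sigma> k] L sqrt2_less_2 by (intro mult_right_mono) auto
  finally show "L2_norm m v \<le> Gamma1 \<sigma> k * L1_norm m u" by (simp add: L_def)
  have sq: "((\<lambda>l. 2 * (norm (t l))\<^sup>2) has_sum (L2_norm m v)\<^sup>2) UNIV"
    by (rule fourier_series_L2(4)[OF t_sum v_sum])
  have "(L2_norm m v)\<^sup>2 = (\<Sum>\<^sub>\<infinity>l. 2 * (norm (t l))\<^sup>2)"
    using infsumI[OF sq] ..
  also have "\<dots> \<le> (Gamma0 \<sigma> k * L)\<^sup>2"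
  proof (rule infsum_le_finite_sums)
    show "(\<lambda>l. 2 * (norm (t l))\<^sup>2) summable_on UNIV" using sq by (rule has_sum_imp_summable)
    fix E :: "int set" assume E: "finite E"
    have "(\<Sum>l\<in>E. 2 * (norm (t l))\<^sup>2) = (\<Sum>l\<in>E \<inter> {l. \<bar>l\<bar> > int k}. 2 * (norm (t l))\<^sup>2)"
      by (rule sum.mono_neutral_right[OF E]) (auto simp: t_def)
    also have "\<dots> \<le> (\<Sum>l\<in>E \<inter> {l. \<bar>l\<bar> > int k}. L\<^sup>2 * (gauss_multiplier \<sigma> l)\<^sup>2)"
    proof (rule sum_mono)
      fix l assume "l \<in> E \<inter> {l. \<bar>l\<bar> > int k}"
      then have "(norm (t l))\<^sup>2 \<le> (gauss_multiplier \<sigma> l * (L / 2))\<^sup>2"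
        using norm_t[of l] by (intro power_mono) auto
      then have "2 * (norm (t l))\<^sup>2 \<le> (1/2) * (L\<^sup>2 * (gauss_multiplier \<sigma> l)\<^sup>2)"
        by (simp add: power_mult_distrib power_divide mult_ac)
      also have "\<dots> \<le> L\<^sup>2 * (gauss_multiplier \<sigma> l)\<^sup>2" by simp
      finally show "2 * (norm (t l))\<^sup>2 \<le> L\<^sup>2 * (gauss_multiplier \<sigma> l)\<^sup>2" .
    qed
    also have "\<dots> = L\<^sup>2 * (\<Sum>l\<in>E \<inter> {l. \<bar>l\<bar> > int k}. (gauss_multiplier \<sigma> l)\<^sup>2)"
      by (rule sum_distrib_left[symmetric])
    also have "\<dots> \<le> L\<^sup>2 * (Gamma0 \<sigma> k)\<^sup>2"
      using E by (intro mult_left_mono tail_power2_le_Gamma0 assms) auto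
    also have "\<dots> = (Gamma0 \<sigma> k * L)\<^sup>2" by (simp add: power_mult_distrib mult.commute)
    finally show "(\<Sum>l\<in>E. 2 * (norm (t l))\<^sup>2) \<le> (Gamma0 \<sigma> k * L)\<^sup>2" .
  qed
  finally have "L2_norm m v \<le> Gamma0 \<sigma> k * L"
    by (rule power2_le_imp_le) (rule mult_nonneg_nonneg[OF Gamma0_nonneg[OF assms(1)] L])
  then show "L2_norm m v \<le> Gamma0 \<sigma> k * L1_norm m u" by (simp only: L_def)
qed

text \<open>
  The trigonometric polynomial on the left is \<open>\<pi>\<^sub>k P\<^sub>\<sigma> v\<close>. Because \<open>v\<close> has mean zero, frequency
  0 is absent and \<open>sum_gaussian_nonzero_le\<close> applies.
\<close>

lemma zero_mean_smoothing:
  fixes k :: nat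
  assumes "\<sigma> > 0" "fourier_coeff v 0 = 0"
  shows "L2_norm m (trig_sum k (\<lambda>l. of_real (gauss_multiplier \<sigma> l) * transfer_coeff T v l))
    \<le> L2_norm lborel (gauss \<sigma>) * L1_norm m v"
proof (rule power2_le_imp_le)
  define L where "L = L1_norm m v"
  define c where "c = (\<lambda>l. of_real (gauss_multiplier \<sigma> l) * transfer_coeff T v l)"
  have L: "L \<ge> 0" unfolding L_def L1_norm_def by (simp add: integral_nonneg_AE)
  have c0: "c 0 = 0"
    using assms(2) by (simp add: c_def transfer_coeff_0 integral_eq_fourier_coeff_0)
  have "(L2_norm m (trig_sum k c))\<^sup>2 = 2 * (\<Sum>l\<in>{l. \<bar>l\<bar> \<le> int k}. (norm (c l))\<^sup>2)"
    by (rule L2_norm_trig_sum)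
  also have "(\<Sum>l\<in>{l. \<bar>l\<bar> \<le> int k}. (norm (c l))\<^sup>2) = (\<Sum>l\<in>{l. \<bar>l\<bar> \<le> int k} - {0}. (norm (c l))\<^sup>2)"
    by (rule sum.mono_neutral_right) (auto simp: c0)
  also have "\<dots> \<le> (\<Sum>l\<in>{l. \<bar>l\<bar> \<le> int k} - {0}. L\<^sup>2 / 4 * exp (- (\<sigma>\<^sup>2 * pi\<^sup>2 * (of_int l)\<^sup>2)))"
  proof (rule sum_mono)
    fix l
    have "(norm (c l))\<^sup>2 \<le> (gauss_multiplier \<sigma> l * (L / 2))\<^sup>2"
      unfolding c_def L_def by (intro power_mono norm_coeff_annealed_le) simp
    then show "(norm (c l))\<^sup>2 \<le> L\<^sup>2 / 4 * exp (- (\<sigma>\<^sup>2 * pi\<^sup>2 * (of_int l)\<^sup>2))"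
      by (simp add: power_mult_distrib power_divide gauss_multiplier_power2 mult_ac)
  qed
  also have "\<dots> = L\<^sup>2 / 4 * (\<Sum>l\<in>{l. \<bar>l\<bar> \<le> int k} - {0}. exp (- (\<sigma>\<^sup>2 * pi\<^sup>2 * (of_int l)\<^sup>2)))"
    by (rule sum_distrib_left[symmetric])
  also have "\<dots> \<le> L\<^sup>2 / 4 * (1 / (\<sigma> * sqrt pi))"
    using sum_gaussian_nonzero_le[of "\<sigma>\<^sup>2 * pi\<^sup>2" "{l. \<bar>l\<bar> \<le> int k} - {0}"] assms(1)
    by (intro mult_left_mono) (simp_all add: sqrt_pi_div)
  also have "2 * (L\<^sup>2 / 4 * (1 / (\<sigma> * sqrt pi))) = (L2_norm lborel (gauss \<sigma>) * L)\<^sup>2"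
    by (simp add: power_mult_distrib L2_norm_gauss[OF assms(1)])
  finally show "(L2_norm m (trig_sum k (\<lambda>l. of_real (gauss_multiplier \<sigma> l) * transfer_coeff T v l)))\<^sup>2
      \<le> (L2_norm lborel (gauss \<sigma>) * L1_norm m v)\<^sup>2"
    by (simp add: c_def L_def)
qed (simp add: L2_norm_nonneg L1_norm_def integral_nonneg_AE)

text \<open>
  Put \<open>v = f - \<pi>\<^sub>k f\<close>. Since \<open>\<pi>\<^sub>k f = \<pi>\<^sub>k P\<^sub>\<sigma> f\<close>, the residual is
  \<open>f - \<pi>\<^sub>k P\<^sub>\<sigma> \<pi>\<^sub>k f = v + \<pi>\<^sub>k P\<^sub>\<sigma> v\<close>. The proof replaces \<open>f\<close> by \<open>F = P\<^sub>\<sigma> f\<close>, which equals it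
  almost everywhere and has a Fourier series at every point.
\<close>

lemma fixed_point_residual:
  assumes "\<sigma> > 0" "nonsingular_map T" "integrable m f"
    and fix_pt: "AE x in m. annealed_PF T \<sigma> f x = f x"
  shows "f \<in> L2"
    and "L2_norm m (\<lambda>x. galerkin_PF T \<sigma> k f x - f x)
      \<le> (1 + L2_norm lborel (gauss \<sigma>)) * Gamma1 \<sigma> k * L1_norm m f"
    and "L2_norm m (\<lambda>x. galerkin_PF T \<sigma> k f x - f x)
      \<le> (Gamma0 \<sigma> k + L2_norm lborel (gauss \<sigma>) * Gamma1 \<sigma> k) * L1_norm m f"
proof -
  define F where "F = annealed_PF T \<sigma> f"
  define v where "v = (\<lambda>x. F x - fourier_proj k F x)"
  define w where "w = trig_sum k (\<lambda>l. of_real (gauss_multiplier \<sigma> l) * transfer_coeff T v l)"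
  define R where "R = L2_norm lborel (gauss \<sigma>)"
  note tail = annealed_PF_tail[OF assms(1-3), where k=k, folded F_def, folded v_def]
  have F_L2: "F \<in> L2"
    unfolding F_def by (rule fourier_series_L2(1)[OF annealed_PF_series[OF assms(1-3)]])
  have meas: "F \<in> borel_measurable m" "f \<in> borel_measurable m"
    using F_L2 assms(3) by (auto simp: L2_def)
  have F_f: "AE x in m. F x = f x" using fix_pt by (simp add: F_def)
  show f_L2: "f \<in> L2"
  proof -
    have "integrable m (\<lambda>x. (norm (f x))\<^sup>2) = integrable m (\<lambda>x. (norm (F x))\<^sup>2)"
      by (rule integrable_cong_AE) (use meas F_f in auto)
    then show ?thesis using F_L2 meas by (simp add: L2_def)
  qed
  have int: "integrable m F" "integrable m (fourier_proj k F)"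
    using F_L2 by (auto simp: L2_imp_integrable fourier_proj_eq_trig_sum integrable_trig_sum)
  have proj_eq: "fourier_proj k f = fourier_proj k F"
    unfolding fourier_proj_eq_trig_sum
    using fourier_coeff_cong_AE[OF F_f meas] by (simp add: fun_eq_iff trig_sum_def)
  have transfer_eq: "transfer_coeff T f l = transfer_coeff T F l" for l
  proof -
    have "(\<integral>x. f x * fourier_basis (- l) (T x) \<partial>m) = (\<integral>x. F x * fourier_basis (- l) (T x) \<partial>m)"
    proof (rule integral_cong_AE)
      show "(\<lambda>x. f x * fourier_basis (- l) (T x)) \<in> borel_measurable m"
        using integrable_transfer[OF assms(2,3)] by (rule borel_measurable_integrable)
      show "(\<lambda>x. F x * fourier_basis (- l) (T x)) \<in> borel_measurable m"
        using integrable_transfer[OF assms(2) int(1)] by (rule borel_measurable_integrable)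
      show "AE x in m. f x * fourier_basis (- l) (T x) = F x * fourier_basis (- l) (T x)"
        using F_f by eventually_elim simp
    qed
    then show ?thesis by (simp add: transfer_coeff_def)
  qed
  have w: "fourier_proj k F x - galerkin_PF T \<sigma> k f x = w x" for x
  proof -
    have "fourier_coeff F = (\<lambda>l. of_real (gauss_multiplier \<sigma> l) * transfer_coeff T f l)"
      unfolding F_def by (rule ext) (rule fourier_series_L2(3)[OF annealed_PF_series[OF assms(1-3)]])
    then have "fourier_proj k F x = trig_sum k (\<lambda>l. of_real (gauss_multiplier \<sigma> l) * transfer_coeff T F l) x"
      by (simp add: fourier_proj_eq_trig_sum transfer_eq)
    moreover have "galerkin_PF T \<sigma> k f x
        = trig_sum k (\<lambda>l. of_real (gauss_multiplier \<sigma> l) * transfer_coeff T (fourier_proj k F) l) x"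
      unfolding galerkin_PF_eq_trig_sum[OF assms(1,2)] proj_eq ..
    ultimately show ?thesis
      unfolding w_def v_def transfer_coeff_diff[OF assms(2) int] right_diff_distrib
      by (simp add: trig_sum_diff)
  qed
  have w_L2: "w \<in> L2" unfolding w_def by (rule trig_sum_L2)
  have "L2_norm m (\<lambda>x. galerkin_PF T \<sigma> k f x - f x) = L2_norm m (\<lambda>x. f x - galerkin_PF T \<sigma> k f x)"
    by (rule L2_norm_minus_commute)
  also have "\<dots> = L2_norm m (\<lambda>x. v x + w x)"
  proof (rule L2_norm_cong_AE)
    show "AE x in m. f x - galerkin_PF T \<sigma> k f x = v x + w x"
      using F_f by eventually_elim (simp add: w[symmetric] v_def)
    show "(\<lambda>x. f x - galerkin_PF T \<sigma> k f x) \<in> borel_measurable m"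
      using L2_sum_diff_product(2)[OF f_L2 galerkin_PF_L2[OF assms(1,2)]] by (simp add: L2_def)
    show "(\<lambda>x. v x + w x) \<in> borel_measurable m"
      using L2_sum_diff_product(1)[OF tail(1) w_L2] by (simp add: L2_def)
  qed
  also have "\<dots> \<le> L2_norm m v + L2_norm m w" by (rule L2_norm_triangle[OF tail(1) w_L2])
  also have "L2_norm m w \<le> R * (Gamma1 \<sigma> k * L1_norm m f)"
  proof -
    have "L1_norm m v \<le> 2 * (Gamma1 \<sigma> k * (L1_norm m f / 2))"
    proof (rule L1_norm_le_bound)
      show "norm (v x) \<le> Gamma1 \<sigma> k * (L1_norm m f / 2)" for x
        using tail(3)[of x] by (simp only: v_def)
    qed (rule L2_imp_integrable[OF tail(1)])
    then have "R * L1_norm m v \<le> R * (Gamma1 \<sigma> k * L1_norm m f)"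
      unfolding R_def by (intro mult_left_mono L2_norm_nonneg) simp
    then show ?thesis
      using zero_mean_smoothing[OF assms(1) tail(2), of k T] unfolding w_def R_def by linarith
  qed
  finally have le: "L2_norm m (\<lambda>x. galerkin_PF T \<sigma> k f x - f x)
      \<le> L2_norm m v + R * (Gamma1 \<sigma> k * L1_norm m f)" by simp
  show "L2_norm m (\<lambda>x. galerkin_PF T \<sigma> k f x - f x)
      \<le> (1 + L2_norm lborel (gauss \<sigma>)) * Gamma1 \<sigma> k * L1_norm m f"
    using le tail(5) unfolding R_def by (simp add: algebra_simps)
  show "L2_norm m (\<lambda>x. galerkin_PF T \<sigma> k f x - f x)
      \<le> (Gamma0 \<sigma> k + L2_norm lborel (gauss \<sigma>) * Gamma1 \<sigma> k) * L1_norm m f"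
    using le tail(4) unfolding R_def by (simp add: algebra_simps)
qed

section \<open>The error of the approximate fixed point\<close>

theorem theorem8p12:
  fixes T :: "real \<Rightarrow> real" and \<sigma> \<epsilon> \<delta> :: real and k n :: nat
    and f\<^sub>\<sigma> g :: "real \<Rightarrow> complex" and C :: "nat \<Rightarrow> real"
  assumes "\<sigma> > 0"
    and "nonsingular_map T"
    and "stationary_density T \<sigma> f\<^sub>\<sigma>"
    and "\<And>i. C i = L2_opnorm_on U0 (galerkin_PF T \<sigma> k ^^ i)"
    and "C n < 1"
    and "trig_poly_degree_le k g"
    and "(\<integral>x. g x \<partial>m) = 1"
    and "L2_norm m (\<lambda>x. galerkin_PF T \<sigma> k g x - g x) \<le> \<epsilon>"
    and "\<delta> = L2_norm m (\<lambda>x. galerkin_PF T \<sigma> k f\<^sub>\<sigma> x - f\<^sub>\<sigma> x)"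
  shows "L2_norm m (\<lambda>x. f\<^sub>\<sigma> x - g x) \<le> 1 / (1 - C n) * (\<Sum>i<n. C i *
           ((1 + Gamma0 \<sigma> k + L2_norm lborel (gauss \<sigma>)) * Gamma1 \<sigma> k * L1_norm m f\<^sub>\<sigma> + \<epsilon>))
    \<and> L2_norm m (\<lambda>x. f\<^sub>\<sigma> x - g x) \<le> 1 / (1 - C n) * (\<Sum>i<n. C i * (\<delta> + \<epsilon>))
    \<and> \<delta> \<le> (Gamma0 \<sigma> k * (1 + Gamma1 \<sigma> k)
              + L2_norm lborel (gauss \<sigma>) * sqrt (coth (1 / (2 * \<sigma>\<^sup>2))) * Gamma1 \<sigma> k) * L1_norm m f\<^sub>\<sigma>"
proof -
  define A where "A = galerkin_PF T \<sigma> k"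
  define R where "R = L2_norm lborel (gauss \<sigma>)"
  define L where "L = L1_norm m f\<^sub>\<sigma>"
  define u where "u = (\<lambda>x. f\<^sub>\<sigma> x - g x)"
  have f: "integrable m f\<^sub>\<sigma>" "(\<integral>x. f\<^sub>\<sigma> x \<partial>m) = 1" "AE x in m. annealed_PF T \<sigma> f\<^sub>\<sigma> x = f\<^sub>\<sigma> x"
    using assms(3) by (auto simp: stationary_density_def)
  note residual = fixed_point_residual[OF assms(1,2) f(1,3)]
  obtain c where "g = trig_sum k c"
    using assms(6) by (auto simp: trig_poly_degree_le_def trig_sum_def fun_eq_iff)
  then have g_L2: "g \<in> L2" by (simp add: trig_sum_L2)
  have g_int: "integrable m g" using g_L2 by (rule L2_imp_integrable)
  have A_L2: "A h \<in> L2" for h unfolding A_def by (rule galerkin_PF_L2[OF assms(1,2)])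
  have u: "u \<in> U0"
    unfolding u_def U0_def using residual(1) g_L2 f g_int assms(7)
    by (simp add: L2_sum_diff_product(2))
  have nonneg: "0 \<le> R" "0 \<le> L" "0 \<le> Gamma0 \<sigma> k" "0 \<le> Gamma1 \<sigma> k" "\<And>i. 0 \<le> C i"
    using galerkin_PF_iterate_opnorm(1)[OF assms(1,2)] assms(4) Gamma0_nonneg[OF assms(1)]
    by (simp_all add: R_def L_def L1_norm_def L2_norm_nonneg Gamma1_nonneg integral_nonneg_AE)
  have defect: "L2_norm m (\<lambda>x. A u x - u x) \<le> \<delta> + \<epsilon>"
  proof -
    have "L2_norm m (\<lambda>x. (A f\<^sub>\<sigma> x - f\<^sub>\<sigma> x) - (A g x - g x)) \<le> \<delta> + L2_norm m (\<lambda>x. A g x - g x)"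
      unfolding assms(9) A_def[symmetric]
      by (intro L2_norm_triangle_diff L2_sum_diff_product(2) A_L2 residual(1) g_L2)
    moreover have "(A f\<^sub>\<sigma> x - f\<^sub>\<sigma> x) - (A g x - g x) = A u x - u x" for x
      unfolding u_def A_def galerkin_PF_diff[OF assms(1,2) f(1) g_int] by simp
    ultimately show ?thesis using assms(8) unfolding A_def by simp
  qed
  have error_le: "L2_norm m u \<le> 1 / (1 - C n) * (\<Sum>i<n. C i * d)" if "\<delta> + \<epsilon> \<le> d" for d
  proof -
    have "(1 - C n) * L2_norm m u \<le> (\<Sum>i<n. C i * L2_norm m (\<lambda>x. A u x - u x))"
      using galerkin_PF_norm_le_defect[OF assms(1,2) u, of n k] by (simp add: A_def assms(4))
    also have "\<dots> \<le> (\<Sum>i<n. C i * d)"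
      using defect that nonneg by (intro sum_mono mult_left_mono) auto
    finally show ?thesis using assms(5) by (simp add: field_simps)
  qed
  have "\<delta> \<le> (1 + R) * Gamma1 \<sigma> k * L"
    using residual(2)[of k] unfolding R_def L_def assms(9) .
  also have "\<dots> \<le> (1 + Gamma0 \<sigma> k + R) * Gamma1 \<sigma> k * L"
    using nonneg by (intro mult_right_mono) auto
  finally have first: "\<delta> \<le> (1 + Gamma0 \<sigma> k + R) * Gamma1 \<sigma> k * L" .
  have "\<delta> \<le> (Gamma0 \<sigma> k + R * Gamma1 \<sigma> k) * L"
    using residual(3)[of k] unfolding R_def L_def assms(9) .
  also have "\<dots> \<le> (Gamma0 \<sigma> k * (1 + Gamma1 \<sigma> k) + R * sqrt (coth (1 / (2 * \<sigma>\<^sup>2))) * Gamma1 \<sigma> k) * L"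
  proof (intro mult_right_mono add_mono)
    show "Gamma0 \<sigma> k \<le> Gamma0 \<sigma> k * (1 + Gamma1 \<sigma> k)"
      using nonneg by (simp add: distrib_left)
    have "1 \<le> sqrt (coth (1 / (2 * \<sigma>\<^sup>2)))" using coth_ge_1[of "1 / (2 * \<sigma>\<^sup>2)"] assms(1) by simp
    from mult_left_mono[OF this nonneg(1)]
    show "R \<le> R * sqrt (coth (1 / (2 * \<sigma>\<^sup>2)))" by simp
  qed (use nonneg in auto)
  finally have second: "\<delta> \<le> (Gamma0 \<sigma> k * (1 + Gamma1 \<sigma> k)
      + R * sqrt (coth (1 / (2 * \<sigma>\<^sup>2))) * Gamma1 \<sigma> k) * L" .
  show ?thesis
    using error_le[of "\<delta> + \<epsilon>"] error_le[OF add_right_mono[OF first, of \<epsilon>]] second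
    unfolding R_def L_def u_def by simp
qed

end
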